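(* Let $n\ge3$, let $g_0$ be the Euclidean metric on $\mathbb{R}^n$ with coordinates $x=(x_1,\dots,x_n)$, and let $r=\sum_{k=1}^nx_k^2$. Then $\left(\mathbb{R}^n\setminus\{0\},\frac{1}{\varphi^2}g_0\right)$ with $\varphi(r)=\sqrt r$ is a complete Riemannian manifold with positive scalar curvature, $\left(\mathbb{R}^n\setminus\{0\},\frac{1}{\varphi_1^2}g_0\right)$ with $$\varphi_1(r)=r\,e^{-\left(1+r^{\frac{n-2}{2}}\right)^{\frac{2}{n-2}}}$$ is a complete Riemannian manifold with negative scalar curvature, and there exists a complete metric of zero scalar curvature on $\mathbb{R}^n\setminus\{0\}$. *)

theory Defs
  imports "HOL-Analysis.Analysis"
begin

text \<open>
  Riemannian geometry on an open subset \<open>U\<close> of \<open>\<real>\<^sup>n\<close> (\<open>real^'n\<close>, with \<open>n = CARD('n)\<close>) in the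
  global Cartesian chart. A metric is the matrix field \<open>x \<mapsto> (g\<^sub>i\<^sub>j(x))\<close> of its components;
  values outside \<open>U\<close> are irrelevant.
\<close>

text \<open>Being \<open>k\<close> times continuously differentiable on an open set \<open>U\<close> of a Euclidean space,
  expressed through iterated directional derivatives.\<close>

primrec ck_on :: "nat \<Rightarrow> 'a::euclidean_space set \<Rightarrow> ('a \<Rightarrow> 'b::real_normed_vector) \<Rightarrow> bool" where
  "ck_on 0 U f \<longleftrightarrow> continuous_on U f"
| "ck_on (Suc k) U f \<longleftrightarrow>
     (\<forall>x\<in>U. f differentiable (at x)) \<and> (\<forall>v. ck_on k U (\<lambda>x. frechet_derivative f (at x) v))"

definition smooth_on :: "'a::euclidean_space set \<Rightarrow> ('a \<Rightarrow> 'b::real_normed_vector) \<Rightarrow> bool" where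
  "smooth_on U f \<longleftrightarrow> (\<forall>k. ck_on k U f)"

definition pderiv_coord :: "'n::finite \<Rightarrow> (real^'n \<Rightarrow> real) \<Rightarrow> real^'n \<Rightarrow> real" where
  "pderiv_coord i f x = frechet_derivative f (at x) (axis i 1)"

definition riemannian_metric_on :: "(real^'n) set \<Rightarrow> (real^'n \<Rightarrow> real^'n^'n::finite) \<Rightarrow> bool" where
  "riemannian_metric_on U g \<longleftrightarrow>
     open U \<and> smooth_on U g \<and>
     (\<forall>x\<in>U. transpose (g x) = g x \<and> (\<forall>v. v \<noteq> 0 \<longrightarrow> 0 < v \<bullet> (g x *v v)))"

text \<open>\<open>christoffel g k i j\<close> is \<open>\<Gamma>\<^sup>k\<^sub>i\<^sub>j\<close>.\<close>

definition christoffel ::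
    "(real^'n \<Rightarrow> real^'n^'n::finite) \<Rightarrow> 'n \<Rightarrow> 'n \<Rightarrow> 'n \<Rightarrow> real^'n \<Rightarrow> real" where
  "christoffel g k i j x =
     (\<Sum>l\<in>UNIV. matrix_inv (g x) $ k $ l *
        (pderiv_coord i (\<lambda>y. g y $ j $ l) x + pderiv_coord j (\<lambda>y. g y $ i $ l) x
          - pderiv_coord l (\<lambda>y. g y $ i $ j) x)) / 2"

text \<open>\<open>riemann_curvature g l k i j\<close> is the \<open>l\<close>-th component of \<open>R(\<partial>\<^sub>i,\<partial>\<^sub>j)\<partial>\<^sub>k\<close>, where
  \<open>R(X,Y)Z = \<nabla>\<^sub>X \<nabla>\<^sub>Y Z - \<nabla>\<^sub>Y \<nabla>\<^sub>X Z - \<nabla>\<^bsub>[X,Y]\<^esub> Z\<close>. The Ricci tensor is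
  \<open>Ric(Y,Z) = tr (X \<mapsto> R(X,Y)Z)\<close>; with these signs round spheres have positive curvature.\<close>

definition riemann_curvature ::
    "(real^'n \<Rightarrow> real^'n^'n::finite) \<Rightarrow> 'n \<Rightarrow> 'n \<Rightarrow> 'n \<Rightarrow> 'n \<Rightarrow> real^'n \<Rightarrow> real" where
  "riemann_curvature g l k i j x =
     pderiv_coord i (christoffel g l j k) x - pderiv_coord j (christoffel g l i k) x
     + (\<Sum>m\<in>UNIV. christoffel g l i m x * christoffel g m j k x
                 - christoffel g l j m x * christoffel g m i k x)"

definition ricci_curvature ::
    "(real^'n \<Rightarrow> real^'n^'n::finite) \<Rightarrow> 'n \<Rightarrow> 'n \<Rightarrow> real^'n \<Rightarrow> real" where
  "ricci_curvature g j k x = (\<Sum>i\<in>UNIV. riemann_curvature g i k i j x)"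

definition scalar_curvature :: "(real^'n \<Rightarrow> real^'n^'n::finite) \<Rightarrow> real^'n \<Rightarrow> real" where
  "scalar_curvature g x =
     (\<Sum>j\<in>UNIV. \<Sum>k\<in>UNIV. matrix_inv (g x) $ j $ k * ricci_curvature g j k x)"

text \<open>The length is taken in \<open>ennreal\<close>, because \<^const>\<open>valid_path\<close> (continuous and \<open>C\<^sup>1\<close> off a finite
  set) allows the speed to be unbounded, and even non-integrable, near the exceptional points; such
  curves of infinite length do not affect the infimum below.\<close>

definition curve_length :: "(real^'n \<Rightarrow> real^'n^'n::finite) \<Rightarrow> (real \<Rightarrow> real^'n) \<Rightarrow> ennreal" where
  "curve_length g c =
     (\<integral>\<^sup>+ t\<in>{0..1}. ennreal (sqrt (vector_derivative c (at t) \<bullet> (g (c t) *v vector_derivative c (at t))))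
        \<partial>lborel)"

definition riemannian_dist ::
    "(real^'n) set \<Rightarrow> (real^'n \<Rightarrow> real^'n^'n::finite) \<Rightarrow> real^'n \<Rightarrow> real^'n \<Rightarrow> real" where
  "riemannian_dist U g x y =
     enn2real (INF c\<in>{c. valid_path c \<and> path_image c \<subseteq> U \<and> pathstart c = x \<and> pathfinish c = y}.
       curve_length g c)"

text \<open>Completeness is completeness of \<open>U\<close> as a metric space under the Riemannian distance. The
  conjunct \<^const>\<open>Metric_space\<close> is automatic for connected \<open>U\<close>. It is needed for
  \<^const>\<open>Metric_space.mcomplete\<close> to be meaningful, and it fails for disconnected \<open>U\<close>, where the infimum
  over the empty set is \<open>\<infinity>\<close> and \<^const>\<open>enn2real\<close> turns it into \<open>0\<close>.\<close>

definition complete_riemannian_manifold ::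
    "(real^'n) set \<Rightarrow> (real^'n \<Rightarrow> real^'n^'n::finite) \<Rightarrow> bool" where
  "complete_riemannian_manifold U g \<longleftrightarrow>
     riemannian_metric_on U g \<and>
     Metric_space U (riemannian_dist U g) \<and>
     Metric_space.mcomplete U (riemannian_dist U g)"

definition euclidean_metric :: "real^'n \<Rightarrow> real^'n^'n::finite" where
  "euclidean_metric x = mat 1"

definition sum_squares :: "real^'n::finite \<Rightarrow> real" where
  "sum_squares x = (\<Sum>k\<in>UNIV. (x $ k)\<^sup>2)"

text \<open>The conformal metric \<open>\<phi>(r)\<^sup>-\<^sup>2 g\<^sub>0\<close> with \<open>r\<close> the sum of the squares of the coordinates.\<close>

definition radial_conformal_metric :: "(real \<Rightarrow> real) \<Rightarrow> real^'n \<Rightarrow> real^'n^'n::finite" where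
  "radial_conformal_metric \<phi> x = (1 / (\<phi> (sum_squares x))\<^sup>2) *\<^sub>R euclidean_metric x"

definition phi :: "real \<Rightarrow> real" where
  "phi r = sqrt r"

definition phi1 :: "nat \<Rightarrow> real \<Rightarrow> real" where
  "phi1 n r = r * exp (- ((1 + r powr ((real n - 2) / 2)) powr (2 / (real n - 2))))"

end

theory Submission
  imports Defs
begin

text \<open>
  For \<open>g = \<phi>(r)\<^sup>-\<^sup>2 g\<^sub>0\<close> the scalar curvature is
  \<open>4 (n - 1) (2 r \<phi> \<phi>'' + n \<phi> \<phi>' - n r \<phi>'\<^sup>2)\<close>. This is \<open>(n - 1) (n - 2)\<close> for \<open>\<phi> = \<surd>r\<close> (the cylinder
  \<open>\<real> \<times> S\<^bsup>n-1\<^esup>\<close>), it is negative for \<open>\<phi>\<^sub>1\<close>, and it vanishes for the Schwarzschild factor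
  \<open>r (1 + r\<^bsup>(n-2)/2\<^esup>)\<^bsup>-2/(n-2)\<^esup>\<close>. All three factors satisfy \<open>\<phi>(r) \<le> \<surd>r\<close>, so the
  metrics dominate the cylindrical metric \<open>\<bar>x\<bar>\<^sup>-\<^sup>2 g\<^sub>0\<close>, which makes them complete.
\<close>

section \<open>Smooth functions\<close>

text \<open>Put a = (n - 2) / 2 and X = \<open>(1 + r powr a) powr (1 / a)\<close>. The zero
  curvature factor is r / X and \<phi>_1 is r exp(- X). Both have the form r exp(- u), and the u of
  \<phi>_1 is the exponential of the u of the Schwarzschild factor. The reference case u = 0 is the
  flat metric that inversion makes of the Euclidean one, so only derivatives of u enter the sign of
  the curvature. The u of the Schwarzschild factor solves the Riccati equation that makes the
  curvature vanish, and passing to its exponential adds terms of a definite sign. Completeness is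
  meant for the distance defined by infima of lengths, so it is reached without geodesics. When the
  weight is at least 1 / |z|, the length of a curve bounds the change of ln |z| along it. Hence a
  Cauchy sequence can approach neither the origin nor infinity, and between these ends it remains to
  compare with Euclidean convergence.\<close>

lemma ck_on_cong:
  assumes "open U" "\<And>x. x \<in> U \<Longrightarrow> f x = g x" "ck_on k U f"
  shows "ck_on k U g"
  using assms(2,3)
proof (induction k arbitrary: f g)
  case 0
  then show ?case by (auto intro: continuous_on_eq)
next
  case (Suc k)
  have D: "(g has_derivative frechet_derivative f (at x)) (at x)" if "x \<in> U" for x
  proof (rule has_derivative_transform_within_open[OF _ \<open>open U\<close> that])
    show "(f has_derivative frechet_derivative f (at x)) (at x)"
      using Suc.prems(2) that frechet_derivative_works by auto
  qed (use Suc.prems in auto)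
  have "ck_on k U (\<lambda>x. frechet_derivative g (at x) v)" for v
  proof (rule Suc.IH[of "\<lambda>x. frechet_derivative f (at x) v"])
    show "frechet_derivative f (at x) v = frechet_derivative g (at x) v" if "x \<in> U" for x
      by (simp only: frechet_derivative_at[OF D[OF that], symmetric])
    show "ck_on k U (\<lambda>x. frechet_derivative f (at x) v)"
      using Suc.prems(2) by simp
  qed
  then show ?case
    using D by (auto simp: differentiable_def)
qed

text \<open>\<open>frechet_derivative\<close> is given by choice, so it must be identified before
  its regularity can be discussed. Doing this once lets the closure proofs work with an explicit
  derivative \<open>D\<close>.\<close>

lemma ck_on_Suc_if_has_derivative:
  assumes "open U" and D: "\<And>x. x \<in> U \<Longrightarrow> (f has_derivative D x) (at x)"
    and ck: "\<And>v. ck_on k U (\<lambda>x. D x v)"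
  shows "ck_on (Suc k) U f"
proof -
  have "ck_on k U (\<lambda>x. frechet_derivative f (at x) v)" for v
    by (rule ck_on_cong[OF \<open>open U\<close> _ ck[of v]])
      (simp only: frechet_derivative_at[OF D, symmetric])
  then show ?thesis
    using D by (auto simp: differentiable_def)
qed

text \<open>The product and chain rules leave undifferentiated factors next to differentiated ones.
  In the inductions these factors are needed one level lower than they are given.\<close>

lemma ck_on_SucD: "ck_on (Suc k) U f \<Longrightarrow> ck_on k U f"
proof (induction k arbitrary: f)
  case 0
  then show ?case
    by (simp add: differentiable_at_imp_differentiable_on differentiable_imp_continuous_on)
next
  case (Suc k)
  have "ck_on k U (\<lambda>x. frechet_derivative f (at x) v)" for v
    using Suc.prems[unfolded ck_on.simps(2)[of "Suc k"]] by (intro Suc.IH) blast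
  then show ?case
    using Suc.prems[unfolded ck_on.simps(2)[of "Suc k"]] by simp
qed

lemma ck_on_has_derivative:
  "ck_on (Suc k) U f \<Longrightarrow> x \<in> U \<Longrightarrow> (f has_derivative frechet_derivative f (at x)) (at x)"
  using frechet_derivative_works by auto

lemma ck_on_const: "ck_on k U (\<lambda>x. c)"
  by (induction k arbitrary: c) (simp_all add: frechet_derivative_const)

lemma ck_on_linear:
  assumes "open U" "bounded_linear L"
  shows "ck_on k U L"
proof (cases k)
  case 0
  then show ?thesis using assms by (simp add: linear_continuous_on)
next
  case (Suc m)
  have "ck_on (Suc m) U L"
    by (rule ck_on_Suc_if_has_derivative[where D = "\<lambda>x. L"])
      (use assms bounded_linear_imp_has_derivative ck_on_const in auto)
  then show ?thesis by (simp add: Suc)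
qed

lemma ck_on_compose_linear:
  assumes "open U" "bounded_linear L" "ck_on k U f"
  shows "ck_on k U (\<lambda>x. L (f x))"
  using assms(3)
proof (induction k arbitrary: f)
  case 0
  then show ?case
    using assms by (simp add: bounded_linear.continuous_on)
next
  case (Suc k)
  show ?case
  proof (rule ck_on_Suc_if_has_derivative[OF \<open>open U\<close>])
    show "((\<lambda>x. L (f x)) has_derivative (\<lambda>v. L (frechet_derivative f (at x) v))) (at x)"
      if "x \<in> U" for x
      using bounded_linear.has_derivative[OF assms(2) ck_on_has_derivative[OF Suc.prems that]] .
  qed (use Suc in auto)
qed

lemma ck_on_add:
  assumes "open U" "ck_on k U f" "ck_on k U g"
  shows "ck_on k U (\<lambda>x. f x + g x)"
  using assms(2,3)
proof (induction k arbitrary: f g)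
  case 0
  then show ?case by (simp add: continuous_on_add)
next
  case (Suc k)
  show ?case
    by (rule ck_on_Suc_if_has_derivative[OF \<open>open U\<close>
        has_derivative_add[OF ck_on_has_derivative[OF Suc.prems(1)] ck_on_has_derivative[OF Suc.prems(2)]]])
      (use Suc in auto)
qed

lemma ck_on_mult:
  fixes f g :: "'a::euclidean_space \<Rightarrow> real"
  assumes "open U" "ck_on k U f" "ck_on k U g"
  shows "ck_on k U (\<lambda>x. f x * g x)"
  using assms(2,3)
proof (induction k arbitrary: f g)
  case 0
  then show ?case by (simp add: continuous_on_mult)
next
  case (Suc k)
  show ?case
  proof (rule ck_on_Suc_if_has_derivative[OF \<open>open U\<close>
        has_derivative_mult[OF ck_on_has_derivative[OF Suc.prems(1)] ck_on_has_derivative[OF Suc.prems(2)]]])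
    show "ck_on k U (\<lambda>x. f x * frechet_derivative g (at x) v + frechet_derivative f (at x) v * g x)" for v
      using Suc by (intro ck_on_add[OF \<open>open U\<close>] Suc.IH) (auto intro: ck_on_SucD)
  qed
qed

text \<open>\<open>H m\<close> plays the role of the \<open>m\<close>-th derivative of the outer function \<open>H 0\<close>.\<close>

lemma ck_on_compose_real:
  fixes f :: "'a::euclidean_space \<Rightarrow> real" and H :: "nat \<Rightarrow> real \<Rightarrow> real"
  assumes "open U" "f ` U \<subseteq> V"
    and H: "\<And>m t. t \<in> V \<Longrightarrow> (H m has_real_derivative H (Suc m) t) (at t)"
    and "ck_on k U f"
  shows "ck_on k U (\<lambda>x. H m (f x))"
  using assms(4)
proof (induction k arbitrary: m)
  case 0
  have "continuous_on V (H m)"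
    by (meson H DERIV_isCont continuous_at_imp_continuous_on)
  then show ?case
    using 0 assms(2) by (auto intro: continuous_on_compose2)
next
  case (Suc k)
  show ?case
  proof (rule ck_on_Suc_if_has_derivative[OF \<open>open U\<close>])
    show "((\<lambda>x. H m (f x)) has_derivative (\<lambda>v. H (Suc m) (f x) * frechet_derivative f (at x) v)) (at x)"
      if "x \<in> U" for x
      using has_derivative_compose[OF ck_on_has_derivative[OF Suc.prems that]
          H[of "f x" m, unfolded has_field_derivative_def]] assms(2) that by auto
    show "ck_on k U (\<lambda>x. H (Suc m) (f x) * frechet_derivative f (at x) v)" for v
      using Suc ck_on_SucD[OF Suc.prems] by (intro ck_on_mult[OF \<open>open U\<close>] Suc.IH) auto
  qed
qed

lemma smooth_on_cong:
  "open U \<Longrightarrow> (\<And>x. x \<in> U \<Longrightarrow> f x = g x) \<Longrightarrow> smooth_on U f \<Longrightarrow> smooth_on U g"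
  unfolding smooth_on_def by (rule allI, rule ck_on_cong[of U f g]) simp_all

lemma smooth_on_const: "smooth_on U (\<lambda>x. c)"
  by (simp add: smooth_on_def ck_on_const)

lemma smooth_on_add:
  "open U \<Longrightarrow> smooth_on U f \<Longrightarrow> smooth_on U g \<Longrightarrow> smooth_on U (\<lambda>x. f x + g x)"
  unfolding smooth_on_def by (intro allI ck_on_add) simp_all

lemma smooth_on_mult:
  fixes f g :: "'a::euclidean_space \<Rightarrow> real"
  shows "open U \<Longrightarrow> smooth_on U f \<Longrightarrow> smooth_on U g \<Longrightarrow> smooth_on U (\<lambda>x. f x * g x)"
  unfolding smooth_on_def by (intro allI ck_on_mult) simp_all

lemma smooth_on_scaleR_left:
  fixes f :: "'a::euclidean_space \<Rightarrow> real"
  shows "open U \<Longrightarrow> smooth_on U f \<Longrightarrow> smooth_on U (\<lambda>x. f x *\<^sub>R c)"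
  unfolding smooth_on_def
  by (rule allI, rule ck_on_compose_linear[OF _ bounded_linear_scaleR_left]) simp_all

lemma smooth_on_exp:
  fixes f :: "'a::euclidean_space \<Rightarrow> real"
  shows "open U \<Longrightarrow> smooth_on U f \<Longrightarrow> smooth_on U (\<lambda>x. exp (f x))"
  unfolding smooth_on_def
  by (rule allI, rule ck_on_compose_real[where V = UNIV and H = "\<lambda>m. exp"]) (auto intro: DERIV_exp)

lemma smooth_on_powr:
  fixes f :: "'a::euclidean_space \<Rightarrow> real"
  assumes "open U" "smooth_on U f" "\<And>x. x \<in> U \<Longrightarrow> 0 < f x"
  shows "smooth_on U (\<lambda>x. f x powr a)"
proof -
  \<comment> \<open>The m-th derivative of \<open>t powr a\<close>: the falling factorial of a times
    the power lowered by m. For m = 0 the empty product leaves \<open>t powr a\<close>.\<close>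
  define H where "H m t = (\<Prod>i<m. a - real i) * t powr (a - real m)" for m and t :: real
  have H: "(H m has_real_derivative H (Suc m) t) (at t)" if "t \<in> {0<..}" for m t
    unfolding H_def using that
    by (auto intro!: derivative_eq_intros simp: algebra_simps)
  have "ck_on k U (\<lambda>x. H 0 (f x))" for k
    by (rule ck_on_compose_real[where V = "{0<..}"]) (use assms H in \<open>auto simp: smooth_on_def\<close>)
  then show ?thesis
    by (simp add: H_def smooth_on_def)
qed

lemma sum_squares_eq_inner: "sum_squares x = x \<bullet> x"
  by (simp add: sum_squares_def inner_vec_def power2_eq_square)

lemma smooth_on_sum_squares:
  fixes U :: "(real^'n::finite) set"
  shows "open U \<Longrightarrow> smooth_on U sum_squares"
  unfolding smooth_on_def
proof
  fix k assume "open U"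
  \<comment> \<open>One level higher than required, so that the rule for explicit derivatives
    applies for every k. For fixed v the derivative is linear in x.\<close>
  have "ck_on (Suc k) U (sum_squares :: real^'n \<Rightarrow> real)"
  proof (rule ck_on_Suc_if_has_derivative[OF \<open>open U\<close>])
    show "(sum_squares has_derivative (\<lambda>v. 2 * (v \<bullet> x))) (at x)" for x :: "real^'n"
      unfolding sum_squares_eq_inner[abs_def]
      by (auto intro!: derivative_eq_intros simp: inner_commute)
    show "ck_on k U (\<lambda>x. 2 * (v \<bullet> x))" for v :: "real^'n"
      using \<open>open U\<close> by (intro ck_on_linear bounded_linear_const_mult bounded_linear_inner_right)
  qed
  then show "ck_on k U (sum_squares :: real^'n \<Rightarrow> real)"
    by (rule ck_on_SucD)
qed

section \<open>Curvature of radial conformal metrics\<close>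

lemma pderiv_coord_eqI:
  assumes "(f has_derivative D) (at x)"
  shows "pderiv_coord i f x = D (axis i 1)"
  using frechet_derivative_at[OF assms] by (simp add: pderiv_coord_def)

text \<open>The Christoffel symbols have their closed form only off the origin, so they are
  differentiated through a function agreeing with them on an open set.\<close>

lemma pderiv_coord_eqI_on:
  assumes "open U" "x \<in> U" "\<And>y. y \<in> U \<Longrightarrow> f y = g y" "(g has_derivative D) (at x)"
  shows "pderiv_coord i f x = D (axis i 1)"
  by (rule pderiv_coord_eqI, rule has_derivative_transform_within_open[OF assms(4,1,2)])
    (use assms(3) in auto)

abbreviation kronecker :: "'n \<Rightarrow> 'n \<Rightarrow> real" where
  "kronecker i j \<equiv> (if i = j then 1 else 0)"

lemma axis_nth_kronecker: "axis i (1::real) $ j = kronecker i j"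
  by (simp add: axis_def)

lemma sum_squares_pos: "x \<noteq> 0 \<Longrightarrow> 0 < sum_squares x"
  by (simp add: sum_squares_eq_inner)

lemma has_derivative_sum_squares:
  fixes x :: "real^'n::finite"
  shows "(sum_squares has_derivative (\<lambda>v. 2 * (x \<bullet> v))) (at x)"
  unfolding sum_squares_eq_inner[abs_def]
  by (auto intro!: derivative_eq_intros simp: inner_commute)

lemma has_derivative_radial:
  fixes x :: "real^'n::finite"
  assumes "(h has_real_derivative h') (at (sum_squares x))"
  shows "((\<lambda>y. h (sum_squares y)) has_derivative (\<lambda>v. 2 * h' * (x \<bullet> v))) (at x)"
  using has_derivative_compose[OF has_derivative_sum_squares assms[unfolded has_field_derivative_def]]
  by (simp add: mult_ac)

lemma matrix_inv_scaleR_mat: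
  fixes c :: real assumes "c \<noteq> 0"
  shows "matrix_inv (c *\<^sub>R mat 1 :: real^'n^'n::finite) = (1 / c) *\<^sub>R mat 1"
proof -
  have *: "(a *\<^sub>R mat 1 :: real^'n^'n) ** (b *\<^sub>R mat 1) = (a * b) *\<^sub>R mat 1" for a b :: real
    by (simp add: vec_eq_iff matrix_matrix_mult_def mat_def if_distrib[of "\<lambda>c. _ * c"] cong: if_cong)
  let ?A = "c *\<^sub>R mat 1 :: real^'n^'n" and ?B = "(1 / c) *\<^sub>R mat 1 :: real^'n^'n"
  have AB: "?A ** ?B = mat 1" "?B ** ?A = mat 1"
    using assms by (simp_all add: *)
  \<comment> \<open>\<open>matrix_inv\<close> chooses some two-sided inverse. The witness
    \<open>?B\<close> shows that the chosen matrix is an inverse of \<open>?A\<close>, and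
    multiplying by \<open>?B\<close> from the left identifies it.\<close>
  then have "?A ** matrix_inv ?A = mat 1"
    unfolding matrix_inv_def by (metis (mono_tags, lifting) someI)
  then have "?B ** (?A ** matrix_inv ?A) = ?B"
    by simp
  then show ?thesis
    by (simp add: matrix_mul_assoc AB)
qed

text \<open>Here \<open>q = - 2 \<phi>' / \<phi>\<close>, so that \<open>x\<^sub>i q(r)\<close> is the \<open>i\<close>-th partial derivative of \<open>- ln \<phi>(r)\<close>;
  in terms of \<open>q\<close> the Christoffel symbols contain no quotient.\<close>

locale radial_conformal =
  fixes \<phi> q q' :: "real \<Rightarrow> real"
  assumes pos: "\<And>r. 0 < r \<Longrightarrow> 0 < \<phi> r"
    and deriv: "\<And>r. 0 < r \<Longrightarrow> (\<phi> has_real_derivative - (\<phi> r * q r / 2)) (at r)"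
    and deriv_q: "\<And>r. 0 < r \<Longrightarrow> (q has_real_derivative q' r) (at r)"
begin

lemma metric_component:
  "radial_conformal_metric \<phi> x $ i $ j = kronecker i j / (\<phi> (sum_squares x))\<^sup>2"
  by (simp add: radial_conformal_metric_def euclidean_metric_def mat_def)

lemma pderiv_metric_component:
  fixes x :: "real^'n::finite"
  assumes "x \<noteq> 0"
  shows "pderiv_coord l (\<lambda>y. radial_conformal_metric \<phi> y $ i $ j) x
    = 2 * kronecker i j * q (sum_squares x) / (\<phi> (sum_squares x))\<^sup>2 * x $ l"
proof -
  define r where "r = sum_squares x"
  have r: "0 < r" using sum_squares_pos[OF assms] by (simp add: r_def)
  have "((\<lambda>t. kronecker i j / (\<phi> t)\<^sup>2) has_real_derivative
      kronecker i j * q r / (\<phi> r)\<^sup>2) (at r)"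
    using pos[OF r] deriv[OF r]
    by (auto intro!: derivative_eq_intros simp: field_simps power2_eq_square)
  from has_derivative_radial[OF this[unfolded r_def]]
  have "((\<lambda>y. radial_conformal_metric \<phi> y $ i $ j) has_derivative
      (\<lambda>v. 2 * (kronecker i j * q (sum_squares x) / (\<phi> (sum_squares x))\<^sup>2) * (x \<bullet> v))) (at x)"
    by (simp add: metric_component)
  from pderiv_coord_eqI[OF this] show ?thesis
    by (simp add: inner_axis)
qed

lemma matrix_inv_metric:
  fixes x :: "real^'n::finite"
  assumes "x \<noteq> 0"
  shows "matrix_inv (radial_conformal_metric \<phi> x) $ i $ j = (\<phi> (sum_squares x))\<^sup>2 * kronecker i j"
  using pos[OF sum_squares_pos[OF assms]]
  unfolding radial_conformal_metric_def euclidean_metric_def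
  by (subst matrix_inv_scaleR_mat) (simp_all add: mat_def)

text \<open>The conformal change formula over a flat background, with conformal exponent f = - ln
  \<phi>(r), whose i-th partial derivative is x_i q(r). The factor \<open>\<phi>\<^sup>2\<close> of
  the inverse metric cancels the \<open>\<phi>\<^sup>-\<^sup>2\<close> of the differentiated
  metric.\<close>

lemma christoffel_eq:
  fixes x :: "real^'n::finite"
  assumes "x \<noteq> 0"
  shows "christoffel (radial_conformal_metric \<phi>) k i j x =
    q (sum_squares x) * (kronecker k i * x $ j + kronecker k j * x $ i - kronecker i j * x $ k)"
proof -
  have "\<phi> (sum_squares x) \<noteq> 0"
    using pos[OF sum_squares_pos[OF assms]] by simp
  moreover have "(\<Sum>l\<in>UNIV. c * kronecker k l * T l) = c * T k" for c and T :: "'n \<Rightarrow> real"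
    by (simp add: if_distrib[of "\<lambda>a. _ * a"] if_distrib[of "\<lambda>a. a * _"] cong: if_cong)
  ultimately show ?thesis
    unfolding christoffel_def pderiv_metric_component[OF assms] matrix_inv_metric[OF assms]
    by (simp only:) (simp add: field_simps)
qed

lemma pderiv_christoffel:
  fixes x :: "real^'n::finite"
  assumes "x \<noteq> 0"
  shows "pderiv_coord l (christoffel (radial_conformal_metric \<phi>) k i j) x =
    2 * q' (sum_squares x) * x $ l
      * (kronecker k i * x $ j + kronecker k j * x $ i - kronecker i j * x $ k)
    + q (sum_squares x)
      * (kronecker k i * kronecker l j + kronecker k j * kronecker l i - kronecker i j * kronecker l k)"
proof -
  let ?D = "\<lambda>v. q (sum_squares x) *
        (kronecker k i * v $ j + kronecker k j * v $ i - kronecker i j * v $ k)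
      + 2 * q' (sum_squares x) * (x \<bullet> v)
        * (kronecker k i * x $ j + kronecker k j * x $ i - kronecker i j * x $ k)"
  have "((\<lambda>y::real^'n. kronecker k i * y $ j + kronecker k j * y $ i - kronecker i j * y $ k)
    has_derivative (\<lambda>v. kronecker k i * v $ j + kronecker k j * v $ i - kronecker i j * v $ k)) (at x)"
    by (intro bounded_linear_imp_has_derivative bounded_linear_sub bounded_linear_add
        bounded_linear_const_mult bounded_linear_vec_nth)
  from has_derivative_mult[OF has_derivative_radial[OF deriv_q[OF sum_squares_pos[OF assms]]] this]
  have D: "((\<lambda>y. q (sum_squares y) *
      (kronecker k i * y $ j + kronecker k j * y $ i - kronecker i j * y $ k)) has_derivative ?D) (at x)" .
  have "christoffel (radial_conformal_metric \<phi>) k i j y = q (sum_squares y) *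
      (kronecker k i * y $ j + kronecker k j * y $ i - kronecker i j * y $ k)"
    if "y \<in> - {0}" for y :: "real^'n"
    by (rule christoffel_eq) (use that in simp)
  from pderiv_coord_eqI_on[OF _ _ this D, where i = l] assms open_Compl[OF closed_singleton]
  have "pderiv_coord l (christoffel (radial_conformal_metric \<phi>) k i j) x = ?D (axis l 1)"
    by blast
  then show ?thesis
    unfolding axis_nth_kronecker by (simp add: inner_axis)
qed

text \<open>The inverse metric is a multiple of the identity, so only the diagonal Ricci entries
  contribute. The facts \<open>1\<close> to \<open>4\<close> are the contractions of the four terms
  of the Riemann tensor, in the order of its definition. Inserting q = - 2 \<phi>' / \<phi> turns
  the result into the formula of the overview.\<close>

lemma scalar_curvature_eq:
  fixes x :: "real^'n::finite"
  assumes "x \<noteq> 0"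
  defines "r \<equiv> sum_squares x" and "n \<equiv> real CARD('n)"
  shows "scalar_curvature (radial_conformal_metric \<phi>) x =
    - (n - 1) * (\<phi> r)\<^sup>2 * (4 * r * q' r + 2 * n * q r + (n - 2) * r * (q r)\<^sup>2)"
proof -
  let ?g = "radial_conformal_metric \<phi>"
  \<comment> \<open>Moving the conditionals of the Kronecker symbols out of products and quotients
    lets the index sums collapse.\<close>
  note [simp] = if_distrib[of "\<lambda>a. _ * a"] if_distrib[of "\<lambda>a. a * _"] if_distrib[of "\<lambda>a. a / _"]
  have [simp]: "(\<Sum>m\<in>UNIV. if P then f m else 0) = (if P then sum f UNIV else 0)"
    for P and f :: "'n \<Rightarrow> real"
    by simp
  have r: "(\<Sum>i\<in>UNIV. (x $ i)\<^sup>2) = r"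
    by (simp add: r_def sum_squares_def)
  have 1: "(\<Sum>j\<in>UNIV. \<Sum>i\<in>UNIV. pderiv_coord i (christoffel ?g i j j) x)
      = (4 * r - 2 * n * r) * q' r + (2 * n - n\<^sup>2) * q r"
  proof -
    have "pderiv_coord i (christoffel ?g i j j) x =
        (if i = j then 4 * q' r * (x $ i)\<^sup>2 + 2 * q r else 0) - (2 * q' r * (x $ i)\<^sup>2 + q r)" for i j
      by (simp add: pderiv_christoffel[OF assms(1)] r_def[symmetric] algebra_simps power2_eq_square)
    then show ?thesis
      by (simp only:, simp add: sum.distrib sum_subtractf sum_distrib_left[symmetric] r n_def[symmetric],
          (simp add: algebra_simps power2_eq_square)?)
  qed
  have 2: "(\<Sum>j\<in>UNIV. \<Sum>i\<in>UNIV. pderiv_coord j (christoffel ?g i i j) x)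
      = 2 * n * r * q' r + n\<^sup>2 * q r"
  proof -
    have "pderiv_coord j (christoffel ?g i i j) x = 2 * q' r * (x $ j)\<^sup>2 + q r" for i j
      by (simp add: pderiv_christoffel[OF assms(1)] r_def[symmetric] algebra_simps power2_eq_square)
    then show ?thesis
      by (simp only:, simp add: sum.distrib sum_distrib_left[symmetric] r n_def[symmetric],
          (simp add: algebra_simps power2_eq_square)?)
  qed
  have 3: "(\<Sum>j\<in>UNIV. \<Sum>i\<in>UNIV. \<Sum>m\<in>UNIV. christoffel ?g i i m x * christoffel ?g m j j x)
      = n * (2 - n) * r * (q r)\<^sup>2"
  proof -
    have "christoffel ?g i i m x * christoffel ?g m j j x =
        (q r)\<^sup>2 * ((if m = j then 2 * (x $ m)\<^sup>2 else 0) - (x $ m)\<^sup>2)" for i j m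
      by (simp add: christoffel_eq[OF assms(1)] r_def[symmetric] algebra_simps power2_eq_square)
    then show ?thesis
      by (simp only:, simp add: sum.distrib sum_subtractf sum_distrib_left[symmetric] r n_def[symmetric],
          (simp add: algebra_simps power2_eq_square)?)
  qed
  have 4: "(\<Sum>j\<in>UNIV. \<Sum>i\<in>UNIV. \<Sum>m\<in>UNIV. christoffel ?g i j m x * christoffel ?g m i j x)
      = (2 - n) * r * (q r)\<^sup>2"
  proof -
    have "christoffel ?g i j m x * christoffel ?g m i j x =
        (q r)\<^sup>2 * ((if i = m then (x $ j)\<^sup>2 else 0) - (if i = j then (x $ m)\<^sup>2 else 0)
          - (if j = m then (x $ i)\<^sup>2 else 0) + (if i = j then if j = m then 2 * (x $ i)\<^sup>2 else 0 else 0))" for i j m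
      by (simp add: christoffel_eq[OF assms(1)] r_def[symmetric] algebra_simps power2_eq_square)
    then show ?thesis
      by (simp only:, simp add: sum.distrib sum_subtractf sum_distrib_left[symmetric] r n_def[symmetric],
          (simp add: algebra_simps power2_eq_square)?)
  qed
  have "scalar_curvature ?g x = (\<phi> r)\<^sup>2 * (\<Sum>j\<in>UNIV. ricci_curvature ?g j j x)"
    by (simp add: scalar_curvature_def matrix_inv_metric[OF assms(1)] r_def sum_distrib_left cong: if_cong)
  also have "(\<Sum>j\<in>UNIV. ricci_curvature ?g j j x) =
      - (n - 1) * (4 * r * q' r + 2 * n * q r + (n - 2) * r * (q r)\<^sup>2)"
    unfolding ricci_curvature_def riemann_curvature_def sum.distrib sum_subtractf 1 2 3 4
    by (simp add: algebra_simps power2_eq_square)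
  finally show ?thesis
    by simp
qed

end

section \<open>Lengths and distances for a continuous weight\<close>

text \<open>The length for the conformal metric \<open>\<rho>\<^sup>2 g\<^sub>0\<close>. Only the
  scalar weight matters for the distance, so matrices can be left out of the whole metric
  argument.\<close>

definition weighted_length :: "('a::euclidean_space \<Rightarrow> real) \<Rightarrow> (real \<Rightarrow> 'a) \<Rightarrow> ennreal" where
  "weighted_length \<rho> c =
     (\<integral>\<^sup>+ t\<in>{0..1}. ennreal (\<rho> (c t) * norm (vector_derivative c (at t))) \<partial>lborel)"

definition paths_in :: "'a::euclidean_space set \<Rightarrow> 'a \<Rightarrow> 'a \<Rightarrow> (real \<Rightarrow> 'a) set" where
  "paths_in U x y = {c. valid_path c \<and> path_image c \<subseteq> U \<and> pathstart c = x \<and> pathfinish c = y}"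

text \<open>A finite set is null, so the unspecified values of \<open>vector_derivative\<close> at
  exceptional points do not affect the integral. With the indicator inside, the integrand lives on
  the whole line, as affine substitutions require.\<close>

lemma weighted_length_eq:
  assumes "finite S" and "\<And>t. t \<in> {0..1} - S \<Longrightarrow> (c has_vector_derivative D t) (at t)"
  shows "weighted_length \<rho> c =
    (\<integral>\<^sup>+ t. ennreal (indicator ({0..1} - S) t * (\<rho> (c t) * norm (D t))) \<partial>lborel)"
  unfolding weighted_length_def
proof (rule nn_integral_cong_AE)
  have "AE t in lborel. t \<notin> S"
    using assms(1) by (intro AE_not_in) (auto simp: finite_imp_null_set_lborel)
  then show "AE t in lborel. ennreal (\<rho> (c t) * norm (vector_derivative c (at t))) * indicator {0..1} t
    = ennreal (indicator ({0..1} - S) t * (\<rho> (c t) * norm (D t)))"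
    by eventually_elim (auto simp: indicator_def vector_derivative_at[OF assms(2)])
qed

lemma valid_pathE:
  assumes "valid_path c"
  obtains S D where "finite S" "\<And>t. t \<in> {0..1} - S \<Longrightarrow> (c has_vector_derivative D t) (at t)"
    "continuous_on ({0..1} - S) D" "continuous_on {0..1} c"
  using assms unfolding valid_path_def piecewise_C1_differentiable_on_def C1_differentiable_on_def
  by blast

lemma speed_borel_measurable:
  fixes S :: "real set" and D :: "real \<Rightarrow> 'a::euclidean_space"
  assumes "finite S" "continuous_on ({0..1} - S) D" "continuous_on {0..1} c"
    and "path_image c \<subseteq> U" "continuous_on U \<rho>"
  shows "(\<lambda>t. indicator ({0..1} - S) t * (\<rho> (c t) * norm (D t))) \<in> borel_measurable borel"
proof -
  have "continuous_on ({0..1} - S) (\<lambda>t. \<rho> (c t))"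
    using assms(3-5) by (intro continuous_on_compose2[OF assms(5)])
      (auto simp: path_image_def elim: continuous_on_subset)
  then have "continuous_on ({0..1} - S) (\<lambda>t. \<rho> (c t) * norm (D t))"
    using assms(2) by (intro continuous_intros)
  moreover have "{0..1} - S \<in> sets borel"
    using assms(1) by (intro sets.Diff) (auto intro: borel_closed finite_imp_closed)
  ultimately show ?thesis
    using borel_measurable_continuous_on_indicator by fastforce
qed

lemma weighted_length_reversepath:
  assumes "valid_path c" "path_image c \<subseteq> U" "continuous_on U \<rho>"
  shows "weighted_length \<rho> (reversepath c) = weighted_length \<rho> c"
proof -
  obtain S D where S: "finite S" and D: "\<And>t. t \<in> {0..1} - S \<Longrightarrow> (c has_vector_derivative D t) (at t)"
    and cont: "continuous_on ({0..1} - S) D" "continuous_on {0..1} c"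
    using valid_pathE[OF assms(1)] by blast
  let ?f = "\<lambda>t. indicator ({0..1} - S) t * (\<rho> (c t) * norm (D t))"
  have "(reversepath c has_vector_derivative - D (1 - t)) (at t)" if "t \<in> {0..1} - (-) 1 ` S" for t
  proof -
    have "1 - t \<in> {0..1} - S"
      using that by (auto simp: image_iff)
    then have "(c has_vector_derivative D (1 - t)) (at (1 - t))"
      by (rule D)
    moreover have "((\<lambda>t. 1 - t) has_vector_derivative - 1) (at t)"
      by (auto intro!: derivative_eq_intros)
    ultimately show ?thesis
      unfolding reversepath_def using vector_diff_chain_at[of "\<lambda>t. 1 - t" "-1" t c "D (1 - t)"]
      by (simp add: o_def)
  qed
  then have "weighted_length \<rho> (reversepath c) =
      (\<integral>\<^sup>+ t. ennreal (indicator ({0..1} - (-) 1 ` S) t * (\<rho> (reversepath c t) * norm (- D (1 - t)))) \<partial>lborel)"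
    using S by (intro weighted_length_eq) auto
  also have "\<dots> = (\<integral>\<^sup>+ t. ennreal (?f (1 + (-1) * t)) \<partial>lborel)"
    by (intro nn_integral_cong) (auto simp: indicator_def reversepath_def image_iff)
  also have "\<dots> = (\<integral>\<^sup>+ t. ennreal (?f t) \<partial>lborel)"
    using nn_integral_real_affine[of "\<lambda>t. ennreal (?f t)" "-1" 1]
      speed_borel_measurable[OF S cont assms(2,3)] by simp
  also have "\<dots> = weighted_length \<rho> c"
    using weighted_length_eq[OF S D, of \<rho>] by simp
  finally show ?thesis .
qed

text \<open>Each half is run at double speed in half the time; the factor 2 is absorbed by the
  substitutions 2 t and 2 t - 1.\<close>

lemma weighted_length_join:
  assumes "valid_path c1" "valid_path c2"
    and "path_image c1 \<subseteq> U" "path_image c2 \<subseteq> U" "continuous_on U \<rho>"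
  shows "weighted_length \<rho> (c1 +++ c2) = weighted_length \<rho> c1 + weighted_length \<rho> c2"
proof -
  obtain S1 D1 where S1: "finite S1"
    and D1: "\<And>t. t \<in> {0..1} - S1 \<Longrightarrow> (c1 has_vector_derivative D1 t) (at t)"
    and cont1: "continuous_on ({0..1} - S1) D1" "continuous_on {0..1} c1"
    using valid_pathE[OF assms(1)] by blast
  obtain S2 D2 where S2: "finite S2"
    and D2: "\<And>t. t \<in> {0..1} - S2 \<Longrightarrow> (c2 has_vector_derivative D2 t) (at t)"
    and cont2: "continuous_on ({0..1} - S2) D2" "continuous_on {0..1} c2"
    using valid_pathE[OF assms(2)] by blast
  let ?f1 = "\<lambda>t. indicator ({0..1} - S1) t * (\<rho> (c1 t) * norm (D1 t))"
  let ?f2 = "\<lambda>t. indicator ({0..1} - S2) t * (\<rho> (c2 t) * norm (D2 t))"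
  have meas [measurable]: "?f1 \<in> borel_measurable borel" "?f2 \<in> borel_measurable borel"
    using speed_borel_measurable[OF S1 cont1 assms(3,5)] speed_borel_measurable[OF S2 cont2 assms(4,5)]
    by auto
  \<comment> \<open>The junction 1/2 is exceptional, since the two one-sided derivatives may differ
    there.\<close>
  define S where "S = (\<lambda>t. 2 * t) -` S1 \<union> (\<lambda>t. 2 * t - 1) -` S2 \<union> {1/2}"
  define D where "D t = (if t < 1/2 then 2 *\<^sub>R D1 (2 * t) else 2 *\<^sub>R D2 (2 * t - 1))" for t
  have S: "finite S"
    using S1 S2 by (auto simp: S_def intro!: finite_vimageI injI)
  have left: "2 * t \<in> {0..1} - S1" if "t \<in> {0..1} - S" "t < 1/2" for t
    using that by (auto simp: S_def)
  have right: "2 * t - 1 \<in> {0..1} - S2" if "t \<in> {0..1} - S" "\<not> t < 1/2" for t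
    using that by (auto simp: S_def)
  have deriv: "((c1 +++ c2) has_vector_derivative D t) (at t)" if t: "t \<in> {0..1} - S" for t
  proof (cases "t < 1/2")
    case True
    have "((\<lambda>t. 2 * t) has_vector_derivative 2) (at t)"
      by (auto intro!: derivative_eq_intros)
    from vector_diff_chain_at[OF this D1[OF left[OF t True]]]
    have "((\<lambda>t. c1 (2 * t)) has_vector_derivative D t) (at t)"
      using True by (simp add: o_def D_def)
    then show ?thesis
      by (rule has_vector_derivative_transform_within_open[where S = "{..<1/2}"])
        (use True in \<open>auto simp: joinpaths_def\<close>)
  next
    case False
    then have "1/2 < t"
      using t by (cases "t = 1/2") (auto simp: S_def)
    have "((\<lambda>t. 2 * t - 1) has_vector_derivative 2) (at t)"
      by (auto intro!: derivative_eq_intros)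
    from vector_diff_chain_at[OF this D2[OF right[OF t False]]]
    have "((\<lambda>t. c2 (2 * t - 1)) has_vector_derivative D t) (at t)"
      using False by (simp add: o_def D_def)
    then show ?thesis
      by (rule has_vector_derivative_transform_within_open[where S = "{1/2<..}"])
        (use \<open>1/2 < t\<close> in \<open>auto simp: joinpaths_def\<close>)
  qed
  have "weighted_length \<rho> (c1 +++ c2) =
      (\<integral>\<^sup>+ t. ennreal (indicator ({0..1} - S) t * (\<rho> ((c1 +++ c2) t) * norm (D t))) \<partial>lborel)"
    by (rule weighted_length_eq[OF S deriv])
  also have "\<dots> = (\<integral>\<^sup>+ t. 2 * ennreal (?f1 (0 + 2 * t)) + 2 * ennreal (?f2 (- 1 + 2 * t)) \<partial>lborel)"
  proof (rule nn_integral_cong_AE)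
    have "AE t in lborel. t \<notin> S"
      using S by (intro AE_not_in) (auto simp: finite_imp_null_set_lborel)
    then show "AE t in lborel. ennreal (indicator ({0..1} - S) t * (\<rho> ((c1 +++ c2) t) * norm (D t)))
      = 2 * ennreal (?f1 (0 + 2 * t)) + 2 * ennreal (?f2 (- 1 + 2 * t))"
    proof eventually_elim
      case (elim t)
      have two: "ennreal (2 * a) = 2 * ennreal a" for a
        by (metis ennreal_mult' ennreal_numeral zero_le_numeral)
      \<comment> \<open>Outside the unit interval all indicators vanish. Inside, exactly one of the
        two halves is active, because 1/2 belongs to \<open>S\<close>.\<close>
      consider "t < 0" | "1 < t" | "t \<in> {0..1} - S" "t < 1/2" | "t \<in> {0..1} - S" "1/2 < t"
        using elim by (cases t "1/2 :: real" rule: linorder_cases) (force simp: S_def)+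
      then show ?case
      proof cases
        case 3
        with left[OF 3] show ?thesis
          by (simp add: D_def joinpaths_def two[symmetric] mult_ac)
      next
        case 4
        with right[OF 4(1)] show ?thesis
          by (simp add: D_def joinpaths_def two[symmetric] mult_ac add.commute[of "-1"])
      qed (auto simp: indicator_def)
    qed
  qed
  also have "\<dots> = 2 * (\<integral>\<^sup>+ t. ennreal (?f1 (0 + 2 * t)) \<partial>lborel)
      + 2 * (\<integral>\<^sup>+ t. ennreal (?f2 (- 1 + 2 * t)) \<partial>lborel)"
    using meas by (subst nn_integral_add)
      (auto simp: nn_integral_cmult intro!: measurable_compose[OF _ meas(1)] measurable_compose[OF _ meas(2)])
  also have "\<dots> = (\<integral>\<^sup>+ t. ennreal (?f1 t) \<partial>lborel) + (\<integral>\<^sup>+ t. ennreal (?f2 t) \<partial>lborel)"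
    using nn_integral_real_affine[of "\<lambda>t. ennreal (?f1 t)" 2 0]
      nn_integral_real_affine[of "\<lambda>t. ennreal (?f2 t)" 2 "-1"] meas by simp
  also have "\<dots> = weighted_length \<rho> c1 + weighted_length \<rho> c2"
    using weighted_length_eq[OF S1 D1, of \<rho>] weighted_length_eq[OF S2 D2, of \<rho>] by simp
  finally show ?thesis .
qed

lemma weighted_length_linepath_le:
  assumes "\<And>z. z \<in> closed_segment x y \<Longrightarrow> \<rho> z \<le> M"
  shows "weighted_length \<rho> (linepath x y) \<le> ennreal (M * norm (y - x))"
proof -
  have "weighted_length \<rho> (linepath x y) \<le> (\<integral>\<^sup>+ t::real\<in>{0..1}. ennreal (M * norm (y - x)) \<partial>lborel)"
    unfolding weighted_length_def
  proof (rule nn_integral_mono)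
    fix t :: real
    show "ennreal (\<rho> (linepath x y t) * norm (vector_derivative (linepath x y) (at t))) * indicator {0..1} t
      \<le> ennreal (M * norm (y - x)) * indicator {0..1} t"
      using assms[OF linepath_in_path[of t x y]]
      by (auto simp: indicator_def intro!: ennreal_leI mult_right_mono)
  qed
  also have "\<dots> = ennreal (M * norm (y - x))"
    by (simp add: nn_integral_cmult)
  finally show ?thesis .
qed

text \<open>The speed of a valid path need not be integrable near its exceptional points, so the increment
  of \<open>F\<close> along the path is computed as a Henstock--Kurzweil integral.\<close>

lemma norm_diff_le_weighted_length:
  fixes F :: "'a::euclidean_space \<Rightarrow> 'b::euclidean_space"
  assumes c: "valid_path c" "path_image c \<subseteq> U"
    and \<rho>: "continuous_on U \<rho>" "\<And>z. z \<in> U \<Longrightarrow> 0 \<le> \<rho> z"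
    and F: "\<And>z. z \<in> U \<Longrightarrow> (F has_derivative F' z) (at z)"
    and bound: "\<And>z v. z \<in> U \<Longrightarrow> norm (F' z v) \<le> K * (\<rho> z * norm v)" and "0 < K"
  shows "ennreal (norm (F (pathfinish c) - F (pathstart c)) / K) \<le> weighted_length \<rho> c"
proof (cases "weighted_length \<rho> c")
  case top
  then show ?thesis by simp
next
  case (real L)
  obtain S D where S: "finite S" and D: "\<And>t. t \<in> {0..1} - S \<Longrightarrow> (c has_vector_derivative D t) (at t)"
    and cont: "continuous_on ({0..1} - S) D" "continuous_on {0..1} c"
    using valid_pathE[OF c(1)] by blast
  let ?f = "\<lambda>t. indicator ({0..1} - S) t * (\<rho> (c t) * norm (D t))"
  have cU: "c t \<in> U" if "t \<in> {0..1}" for t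
    using c(2) that by (auto simp: path_image_def)
  have "(?f has_integral L) UNIV"
  proof (rule nn_integral_has_integral)
    show "?f \<in> borel_measurable borel"
      by (rule speed_borel_measurable[OF S cont c(2) \<rho>(1)])
    show "0 \<le> ?f t" for t
      using \<rho>(2)[OF cU] by (simp add: indicator_def)
    show "(\<integral>\<^sup>+ t. ennreal (?f t) \<partial>lborel) = ennreal L"
      using weighted_length_eq[OF S D, of \<rho>] real by simp
  qed (use real in auto)
  then have "((\<lambda>t. if t \<in> {0..1} then ?f t else 0) has_integral L) UNIV"
    by (rule has_integral_eq[rotated]) (auto simp: indicator_def)
  then have f: "(?f has_integral L) {0..1}"
    by (simp only: has_integral_restrict_UNIV)
  \<comment> \<open>The value 0 on \<open>S\<close> is an arbitrary default: the fundamental theorem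
    used here allows finitely many points at which only continuity is known.\<close>
  let ?G = "\<lambda>t. if t \<in> S then 0 else F' (c t) (D t)"
  have G: "(?G has_integral F (c 1) - F (c 0)) {0..1}"
  proof (rule fundamental_theorem_of_calculus_strong[OF S])
    show "((\<lambda>t. F (c t)) has_vector_derivative ?G t) (at t)" if "t \<in> {0..1} - S" for t
      using vector_derivative_diff_chain_within[of c "D t" t UNIV F "F' (c t)"] D[OF that]
        F[OF cU] that by (auto simp: o_def intro: has_derivative_at_withinI)
    have "continuous_on U F"
      using F has_derivative_continuous continuous_at_imp_continuous_on by blast
    then show "continuous_on {0..1} (\<lambda>t. F (c t))"
      by (rule continuous_on_compose2[OF _ cont(2)]) (use cU in auto)
  qed simp
  have "norm (integral {0..1} ?G) \<le> integral {0..1} (\<lambda>t. K * ?f t)"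
    using G f bound cU \<open>0 < K\<close>
    by (intro integral_norm_bound_integral integrable_on_mult_right)
      (auto simp: has_integral_integrable_integral indicator_def)
  then have "norm (F (c 1) - F (c 0)) \<le> K * L"
    using integral_unique[OF G] integral_unique[OF f] by simp
  then show ?thesis
    using real \<open>0 < K\<close> by (auto simp: pathfinish_def pathstart_def field_simps intro!: ennreal_leI)
qed

text \<open>Taking values in \<open>ennreal\<close> makes the triangle inequality hold without
  asking whether connecting paths exist; the passage to reals waits until finiteness is
  known.\<close>

definition weighted_dist :: "'a::euclidean_space set \<Rightarrow> ('a \<Rightarrow> real) \<Rightarrow> 'a \<Rightarrow> 'a \<Rightarrow> ennreal" where
  "weighted_dist U \<rho> x y = (INF c\<in>paths_in U x y. weighted_length \<rho> c)"

lemma reversepath_in_paths_in: "c \<in> paths_in U x y \<Longrightarrow> reversepath c \<in> paths_in U y x"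
  by (simp add: paths_in_def)

lemma joinpaths_in_paths_in:
  assumes "c1 \<in> paths_in U x y" "c2 \<in> paths_in U y z"
  shows "c1 +++ c2 \<in> paths_in U x z"
  using assms path_image_join_subset[of c1 c2] by (auto simp: paths_in_def intro: valid_path_join)

lemma weighted_dist_commute:
  assumes "continuous_on U \<rho>"
  shows "weighted_dist U \<rho> x y = weighted_dist U \<rho> y x"
proof -
  have "weighted_dist U \<rho> x y \<le> weighted_dist U \<rho> y x" for x y
    unfolding weighted_dist_def
  proof (rule INF_mono)
    fix c assume c: "c \<in> paths_in U y x"
    then have "weighted_length \<rho> (reversepath c) \<le> weighted_length \<rho> c"
      using weighted_length_reversepath[OF _ _ assms] by (auto simp: paths_in_def)
    then show "\<exists>b\<in>paths_in U x y. weighted_length \<rho> b \<le> weighted_length \<rho> c"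
      using reversepath_in_paths_in[OF c] by blast
  qed
  then show ?thesis by (simp add: antisym)
qed

lemma weighted_dist_triangle:
  assumes "continuous_on U \<rho>"
  shows "weighted_dist U \<rho> x z \<le> weighted_dist U \<rho> x y + weighted_dist U \<rho> y z"
proof (rule ennreal_le_epsilon)
  fix e :: real assume e: "0 < e" and "weighted_dist U \<rho> x y + weighted_dist U \<rho> y z < top"
  then have fin: "weighted_dist U \<rho> x y < top" "weighted_dist U \<rho> y z < top"
    by (simp_all add: ennreal_add_less_top)
  define a where "a = weighted_dist U \<rho> x y + ennreal (e / 2)"
  define b where "b = weighted_dist U \<rho> y z + ennreal (e / 2)"
  have "weighted_dist U \<rho> x y < a" "weighted_dist U \<rho> y z < b"
    using e fin ennreal_add_left_cancel_less[of _ 0] by (simp_all add: a_def b_def)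
  then obtain c1 c2 where c: "c1 \<in> paths_in U x y" "c2 \<in> paths_in U y z"
    and len: "weighted_length \<rho> c1 < a" "weighted_length \<rho> c2 < b"
    unfolding weighted_dist_def INF_less_iff by blast
  have "weighted_dist U \<rho> x z \<le> weighted_length \<rho> (c1 +++ c2)"
    unfolding weighted_dist_def by (rule INF_lower[OF joinpaths_in_paths_in[OF c]])
  also have "\<dots> = weighted_length \<rho> c1 + weighted_length \<rho> c2"
    using c weighted_length_join[OF _ _ _ _ assms] by (auto simp: paths_in_def)
  also have "\<dots> \<le> a + b"
    using len by (intro add_mono) auto
  also have "\<dots> = weighted_dist U \<rho> x y + weighted_dist U \<rho> y z + (ennreal (e / 2) + ennreal (e / 2))"
    by (simp only: a_def b_def ac_simps)
  also have "ennreal (e / 2) + ennreal (e / 2) = ennreal e"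
    using e by (simp flip: ennreal_plus)
  finally show "weighted_dist U \<rho> x z \<le> weighted_dist U \<rho> x y + weighted_dist U \<rho> y z + ennreal e" .
qed

lemma weighted_dist_segment_le:
  assumes "closed_segment x y \<subseteq> U" "\<And>z. z \<in> closed_segment x y \<Longrightarrow> \<rho> z \<le> M"
  shows "weighted_dist U \<rho> x y \<le> ennreal (M * norm (y - x))"
proof -
  have "linepath x y \<in> paths_in U x y"
    using assms(1) by (simp add: paths_in_def)
  then show ?thesis
    unfolding weighted_dist_def
    by (rule INF_lower2) (rule weighted_length_linepath_le[OF assms(2)])
qed

text \<open>A continuous weight is bounded on a small closed ball, and segments stay in it. This
  serves twice: for finiteness of the distance, and to turn Euclidean convergence into convergence
  in the distance.\<close>

lemma weighted_dist_locally_le: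
  assumes "open U" "continuous_on U \<rho>" "p \<in> U"
  obtains \<delta> M where "0 < \<delta>" "0 < M" "ball p \<delta> \<subseteq> U"
    "\<And>y. y \<in> ball p \<delta> \<Longrightarrow> weighted_dist U \<rho> p y \<le> ennreal (M * norm (y - p))"
proof -
  obtain \<delta> where \<delta>: "0 < \<delta>" "cball p \<delta> \<subseteq> U"
    using assms(1,3) open_contains_cball by blast
  have "compact (\<rho> ` cball p \<delta>)"
    using assms(2) \<delta>(2) by (intro compact_continuous_image) (auto elim: continuous_on_subset)
  then obtain M where "0 < M" and "\<And>z. z \<in> cball p \<delta> \<Longrightarrow> norm (\<rho> z) \<le> M"
    by (auto dest!: compact_imp_bounded simp: bounded_pos)
  then have M: "0 < M" "\<And>z. z \<in> cball p \<delta> \<Longrightarrow> \<rho> z \<le> M"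
    by (auto simp: abs_le_iff)
  have "weighted_dist U \<rho> p y \<le> ennreal (M * norm (y - p))" if "y \<in> ball p \<delta>" for y
  proof (rule weighted_dist_segment_le)
    have "closed_segment p y \<subseteq> cball p \<delta>"
      using that \<delta>(1) by (intro closed_segment_subset) auto
    then show "closed_segment p y \<subseteq> U" "\<And>z. z \<in> closed_segment p y \<Longrightarrow> \<rho> z \<le> M"
      using \<delta>(2) M(2) by blast+
  qed
  moreover have "ball p \<delta> \<subseteq> U"
    using \<delta> ball_subset_cball by blast
  ultimately show ?thesis
    using that \<delta>(1) M(1) by blast
qed

text \<open>Being at finite distance is an equivalence relation whose classes are open, so a
  connected set is a single class.\<close>

lemma weighted_dist_finite:
  assumes "open U" "connected U" "continuous_on U \<rho>" "x \<in> U" "y \<in> U"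
  shows "weighted_dist U \<rho> x y < \<infinity>"
proof (rule connected_equivalence_relation[OF assms(2,4,5), where R = "\<lambda>x y. weighted_dist U \<rho> x y < \<infinity>"])
  show "weighted_dist U \<rho> y x < \<infinity>" if "weighted_dist U \<rho> x y < \<infinity>" for x y
    using that weighted_dist_commute[OF assms(3)] by metis
  show "weighted_dist U \<rho> x z < \<infinity>"
    if "weighted_dist U \<rho> x y < \<infinity>" "weighted_dist U \<rho> y z < \<infinity>" for x y z
    by (rule order_le_less_trans[OF weighted_dist_triangle[OF assms(3), of x z y]])
      (use that in \<open>simp add: ennreal_add_less_top\<close>)
  show "\<exists>T. openin (top_of_set U) T \<and> p \<in> T \<and> (\<forall>y\<in>T. weighted_dist U \<rho> p y < \<infinity>)"
    if p: "p \<in> U" for p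
  proof -
    obtain \<delta> M where \<delta>: "0 < \<delta>" "ball p \<delta> \<subseteq> U"
      and M: "\<And>y. y \<in> ball p \<delta> \<Longrightarrow> weighted_dist U \<rho> p y \<le> ennreal (M * norm (y - p))"
      using weighted_dist_locally_le[OF assms(1,3) p] by metis
    have "openin (top_of_set U) (ball p \<delta>)"
      using \<delta>(2) by (simp add: open_openin_trans open_subset)
    moreover have "weighted_dist U \<rho> p y < \<infinity>" if "y \<in> ball p \<delta>" for y
      by (rule order_le_less_trans[OF M[OF that]]) simp
    ultimately show ?thesis
      using \<delta>(1) by (metis centre_in_ball)
  qed
qed

lemma norm_diff_le_weighted_dist:
  fixes F :: "'a::euclidean_space \<Rightarrow> 'b::euclidean_space"
  assumes "continuous_on U \<rho>" "\<And>z. z \<in> U \<Longrightarrow> 0 \<le> \<rho> z"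
    and "\<And>z. z \<in> U \<Longrightarrow> (F has_derivative F' z) (at z)"
    and "\<And>z v. z \<in> U \<Longrightarrow> norm (F' z v) \<le> K * (\<rho> z * norm v)" and "0 < K"
    and "weighted_dist U \<rho> x y < \<infinity>"
  shows "norm (F y - F x) \<le> K * enn2real (weighted_dist U \<rho> x y)"
proof -
  have "ennreal (norm (F y - F x) / K) \<le> weighted_dist U \<rho> x y"
    unfolding weighted_dist_def
  proof (rule INF_greatest)
    fix c assume "c \<in> paths_in U x y"
    then show "ennreal (norm (F y - F x) / K) \<le> weighted_length \<rho> c"
      using norm_diff_le_weighted_length[OF _ _ assms(1-5), of c] by (auto simp: paths_in_def)
  qed
  then have "norm (F y - F x) / K \<le> enn2real (weighted_dist U \<rho> x y)"
    using assms(5,6) by (cases "weighted_dist U \<rho> x y") auto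
  then show ?thesis
    using assms(5) by (simp add: field_simps)
qed

section \<open>Completeness of the punctured space\<close>

text \<open>\<open>F\<close> and \<open>G\<close> below are Lipschitz for the distance and together determine the point, so they
  separate points and turn Cauchy sequences into Euclidean convergent ones whose limit is not \<open>0\<close>.\<close>

lemma complete_punctured_space:
  fixes \<rho> :: "'a::euclidean_space \<Rightarrow> real"
  assumes dim: "2 \<le> DIM('a)" and cont: "continuous_on (- {0}) \<rho>"
    and lower: "\<And>z. z \<noteq> 0 \<Longrightarrow> 1 / norm z \<le> \<rho> z"
  defines "d \<equiv> \<lambda>x y. enn2real (weighted_dist (- {0}) \<rho> x y)"
  shows "Metric_space (- {0}) d" "Metric_space.mcomplete (- {0}) d"
proof -
  have U: "open (- {0::'a})" "connected (- {0::'a})"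
    using connected_punctured_universe[OF dim] by auto
  have \<rho>: "0 \<le> \<rho> z" if "z \<in> - {0}" for z
    using lower[of z] that by (auto intro: order_trans[rotated])
  note fin = weighted_dist_finite[OF U cont]
  \<comment> \<open>\<open>F\<close> is twice the axial coordinate ln |z| of the cylinder. The
    identity map would not be Lipschitz far out; the damping in \<open>G\<close> brings its
    differential below 3 / |z|, and it can be undone because 1 + |z|^2 is 1 + exp (F z).\<close>
  define F where "F = (\<lambda>z::'a. ln (z \<bullet> z))"
  define G where "G = (\<lambda>z::'a. (1 / (1 + z \<bullet> z)) *\<^sub>R z)"
  have F: "norm (F y - F x) \<le> 2 * d x y" if "x \<noteq> 0" "y \<noteq> 0" for x y
    unfolding d_def
  proof (rule norm_diff_le_weighted_dist[OF cont \<rho>])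
    show "(F has_derivative (\<lambda>v. 2 * (z \<bullet> v) / (z \<bullet> z))) (at z)" if "z \<in> - {0}" for z
      unfolding F_def using that
      by (auto intro!: derivative_eq_intros simp: inner_commute divide_inverse)
    show "norm (2 * (z \<bullet> v) / (z \<bullet> z)) \<le> 2 * (\<rho> z * norm v)" if "z \<in> - {0}" for z v :: 'a
    proof -
      have "norm (2 * (z \<bullet> v) / (z \<bullet> z)) = 2 * \<bar>z \<bullet> v\<bar> / (norm z)\<^sup>2"
        by (simp add: abs_mult power2_norm_eq_inner)
      also have "\<dots> \<le> 2 * (norm z * norm v) / (norm z)\<^sup>2"
        using Cauchy_Schwarz_ineq2[of z v] by (intro divide_right_mono mult_left_mono) auto
      also have "\<dots> = 2 * (1 / norm z * norm v)"
        using that by (simp add: power2_eq_square)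
      also have "\<dots> \<le> 2 * (\<rho> z * norm v)"
        using lower that by (intro mult_left_mono mult_right_mono) auto
      finally show ?thesis .
    qed
  qed (use fin that in auto)
  have G: "norm (G y - G x) \<le> 3 * d x y" if "x \<noteq> 0" "y \<noteq> 0" for x y
    unfolding d_def
  proof (rule norm_diff_le_weighted_dist[OF cont \<rho>])
    let ?G' = "\<lambda>z v. (1 / (1 + z \<bullet> z)) *\<^sub>R v - (2 * (z \<bullet> v) / (1 + z \<bullet> z)\<^sup>2) *\<^sub>R z"
    show "(G has_derivative ?G' z) (at z)" for z
    proof -
      have "1 + z \<bullet> z \<noteq> 0"
        using inner_ge_zero[of z] by linarith
      then show ?thesis
        unfolding G_def
        by (auto intro!: derivative_eq_intros simp: inner_commute power2_eq_square divide_inverse)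
    qed
    show "norm (?G' z v) \<le> 3 * (\<rho> z * norm v)" if "z \<in> - {0}" for z v :: 'a
    proof -
      define s where "s = norm z"
      have s: "0 < s" "z \<bullet> z = s\<^sup>2"
        using that by (auto simp: s_def power2_norm_eq_inner)
      have "norm (?G' z v) \<le> norm v / (1 + s\<^sup>2) + 2 * \<bar>z \<bullet> v\<bar> / (1 + s\<^sup>2)\<^sup>2 * s"
        by (rule order_trans[OF norm_triangle_ineq4]) (simp add: s abs_mult s_def)
      also have "\<dots> \<le> norm v / (1 + s\<^sup>2) + 2 * (s * norm v) / (1 + s\<^sup>2)\<^sup>2 * s"
        using Cauchy_Schwarz_ineq2[of z v] s
        by (intro add_left_mono mult_right_mono divide_right_mono mult_left_mono) (auto simp: s_def)
      also have "\<dots> = (1 + 2 * (s\<^sup>2 / (1 + s\<^sup>2))) * (norm v / (1 + s\<^sup>2))"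
        by (simp add: power2_eq_square algebra_simps add_divide_distrib)
      \<comment> \<open>The constant 3 is 1 + 2, from the two summands of the differential of
        \<open>G\<close>.\<close>
      also have "\<dots> \<le> 3 * (norm v / s)"
      proof (intro mult_mono divide_left_mono)
        have "s\<^sup>2 / (1 + s\<^sup>2) \<le> 1"
          by (simp add: divide_le_eq add_pos_nonneg)
        then show "1 + 2 * (s\<^sup>2 / (1 + s\<^sup>2)) \<le> 3"
          by simp
        show "s \<le> 1 + s\<^sup>2"
          using sum_power2_ge_zero[of "s - 1" 0] s(1) by (simp add: power2_eq_square algebra_simps)
      qed (use s in \<open>auto intro!: mult_pos_pos add_pos_nonneg\<close>)
      also have "\<dots> = 3 * (1 / norm z * norm v)"
        by (simp add: s_def)
      also have "\<dots> \<le> 3 * (\<rho> z * norm v)"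
        using lower that by (intro mult_left_mono mult_right_mono) auto
      finally show ?thesis .
    qed
  qed (use fin that in auto)
  have recover: "z = (1 + exp (F z)) *\<^sub>R G z" if "z \<noteq> 0" for z
  proof -
    have "1 + z \<bullet> z \<noteq> 0"
      using inner_ge_zero[of z] by linarith
    then show ?thesis
      using that by (simp add: F_def G_def)
  qed
  have d_self: "d x x = 0" if "x \<noteq> 0" for x
    using weighted_dist_segment_le[of x x "- {0}" \<rho> "\<rho> x"] that by (simp add: d_def)
  show metric: "Metric_space (- {0}) d"
  proof
    show "d x y = d y x" for x y
      by (simp add: d_def weighted_dist_commute[OF cont, of x])
    show "d x y = 0 \<longleftrightarrow> x = y" if "x \<in> - {0}" "y \<in> - {0}" for x y
    proof
      assume "d x y = 0"
      then have "F x = F y" "G x = G y"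
        using F[of x y] G[of x y] that by auto
      then show "x = y"
        using recover[of x] recover[of y] that by simp
    qed (use d_self that in auto)
    show "d x z \<le> d x y + d y z" if "x \<in> - {0}" "y \<in> - {0}" "z \<in> - {0}" for x y z
    proof -
      have "d x z \<le> enn2real (weighted_dist (- {0}) \<rho> x y + weighted_dist (- {0}) \<rho> y z)"
        unfolding d_def
        by (rule enn2real_mono[OF weighted_dist_triangle[OF cont]])
          (use fin that in \<open>simp add: ennreal_add_less_top\<close>)
      also have "\<dots> = d x y + d y z"
        using fin that by (simp add: d_def enn2real_plus)
      finally show ?thesis .
    qed
  qed (simp add: d_def)
  interpret Metric_space "- {0}" d by (fact metric)
  show mcomplete
    unfolding mcomplete_def
  proof (intro allI impI)
    fix \<sigma> assume \<sigma>: "MCauchy \<sigma>"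
    then have nz: "\<sigma> n \<noteq> 0" for n
      by (auto simp: MCauchy_def)
    have Cauchy: "Cauchy (\<lambda>n. H (\<sigma> n))"
      if "0 < K" and H: "\<And>x y. x \<noteq> 0 \<Longrightarrow> y \<noteq> 0 \<Longrightarrow> norm (H y - H x) \<le> K * d x y"
      for K :: real and H :: "'a \<Rightarrow> 'b::real_normed_vector"
      unfolding Cauchy_def
    proof (intro allI impI)
      fix e :: real assume "0 < e"
      then obtain N where N: "\<And>m n. N \<le> m \<Longrightarrow> N \<le> n \<Longrightarrow> d (\<sigma> m) (\<sigma> n) < e / K"
        using \<sigma> \<open>0 < K\<close> unfolding MCauchy_def by (meson divide_pos_pos)
      have "dist (H (\<sigma> m)) (H (\<sigma> n)) < e" if "N \<le> m" "N \<le> n" for m n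
      proof -
        have "dist (H (\<sigma> m)) (H (\<sigma> n)) \<le> K * d (\<sigma> n) (\<sigma> m)"
          using H nz by (simp add: dist_norm)
        also have "\<dots> < e"
          using N[OF that(2,1)] \<open>0 < K\<close> by (simp add: field_simps)
        finally show ?thesis .
      qed
      then show "\<exists>M. \<forall>m\<ge>M. \<forall>n\<ge>M. dist (H (\<sigma> m)) (H (\<sigma> n)) < e"
        by blast
    qed
    obtain l where l: "(\<lambda>n. F (\<sigma> n)) \<longlonglongrightarrow> l"
      using Cauchy[of 2 F] F by (auto simp: Cauchy_convergent_iff convergent_def)
    obtain w where w: "(\<lambda>n. G (\<sigma> n)) \<longlonglongrightarrow> w"
      using Cauchy[of 3 G] G by (auto simp: Cauchy_convergent_iff convergent_def)
    define p where "p = (1 + exp l) *\<^sub>R w"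
    have "(\<lambda>n. (1 + exp (F (\<sigma> n))) *\<^sub>R G (\<sigma> n)) \<longlonglongrightarrow> p"
      unfolding p_def by (intro tendsto_intros l w)
    then have lim: "\<sigma> \<longlonglongrightarrow> p"
      using recover[OF nz] by simp
    \<comment> \<open>Here the origin is excluded as a limit: the squared norms are exponentials of
      the convergent sequence \<open>F (\<sigma> n)\<close>.\<close>
    have "(\<lambda>n. \<sigma> n \<bullet> \<sigma> n) \<longlonglongrightarrow> exp l"
      using tendsto_exp[OF l] nz by (simp add: F_def)
    then have "p \<bullet> p = exp l"
      using LIMSEQ_unique tendsto_inner[OF lim lim] by blast
    then have p: "p \<in> - {0}"
      by auto
    obtain \<delta> M where \<delta>: "0 < \<delta>" and M: "0 < M"
      "\<And>y. y \<in> ball p \<delta> \<Longrightarrow> weighted_dist (- {0}) \<rho> p y \<le> ennreal (M * norm (y - p))"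
      using weighted_dist_locally_le[OF U(1) cont p] by metis
    have "\<exists>N. \<forall>n\<ge>N. \<sigma> n \<in> - {0} \<and> d (\<sigma> n) p < e" if "0 < e" for e
    proof -
      have "0 < min \<delta> (e / M)"
        using \<delta> M that by simp
      then obtain N where N: "\<And>n. N \<le> n \<Longrightarrow> dist (\<sigma> n) p < min \<delta> (e / M)"
        using lim unfolding lim_sequentially by blast
      have "d (\<sigma> n) p < e" if "N \<le> n" for n
      proof -
        have "d p (\<sigma> n) \<le> M * norm (\<sigma> n - p)"
          unfolding d_def using N[OF that] M by (intro enn2real_leI) (auto simp: dist_commute)
        also have "\<dots> < e"
          using N[OF that] M(1) by (simp add: dist_norm field_simps)
        finally show ?thesis
          by (simp add: commute)
      qed
      then show ?thesis
        using nz by auto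
    qed
    then show "\<exists>x. limitin mtopology \<sigma> x sequentially"
      using p by (auto simp: limit_metric_sequentially)
  qed
qed

section \<open>The Riemannian distance as a weighted distance\<close>

lemma curve_length_radial_conformal_metric:
  assumes "\<And>r. 0 < r \<Longrightarrow> 0 < \<phi> r" "path_image c \<subseteq> - {0}"
  shows "curve_length (radial_conformal_metric \<phi>) c = weighted_length (\<lambda>z. 1 / \<phi> (sum_squares z)) c"
  unfolding curve_length_def weighted_length_def
proof (intro nn_integral_cong)
  fix t :: real
  let ?v = "vector_derivative c (at t)"
  have "sqrt (?v \<bullet> (radial_conformal_metric \<phi> (c t) *v ?v)) = 1 / \<phi> (sum_squares (c t)) * norm ?v"
    if "t \<in> {0..1}"
  proof -
    have "c t \<noteq> 0"
      using assms(2) that by (auto simp: path_image_def)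
    then have "0 < \<phi> (sum_squares (c t))"
      using assms(1) sum_squares_pos by blast
    moreover have "radial_conformal_metric \<phi> (c t) *v ?v = (1 / (\<phi> (sum_squares (c t)))\<^sup>2) *\<^sub>R ?v"
      by (simp add: radial_conformal_metric_def euclidean_metric_def flip: scaleR_matrix_vector_assoc)
    ultimately show ?thesis
      by (simp add: real_sqrt_divide real_sqrt_mult norm_eq_sqrt_inner)
  qed
  then show "ennreal (sqrt (?v \<bullet> (radial_conformal_metric \<phi> (c t) *v ?v))) * indicator {0..1} t
    = ennreal (1 / \<phi> (sum_squares (c t)) * norm ?v) * indicator {0..1} t"
    by (simp add: indicator_def)
qed

lemma riemannian_dist_radial_conformal_metric:
  assumes "\<And>r. 0 < r \<Longrightarrow> 0 < \<phi> r"
  shows "riemannian_dist (- {0}) (radial_conformal_metric \<phi>) =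
    (\<lambda>x y. enn2real (weighted_dist (- {0}) (\<lambda>z. 1 / \<phi> (sum_squares z)) x y))"
proof (intro ext)
  fix x y :: "real^'n"
  show "riemannian_dist (- {0}) (radial_conformal_metric \<phi>) x y =
    enn2real (weighted_dist (- {0}) (\<lambda>z. 1 / \<phi> (sum_squares z)) x y)"
    unfolding riemannian_dist_def weighted_dist_def paths_in_def
    by (intro arg_cong[where f = enn2real] INF_cong curve_length_radial_conformal_metric assms) auto
qed

text \<open>Since sqrt r = |z|, the bound \<open>le\<close> says that the weight 1 / \<phi>(r) is at
  least 1 / |z|, that is, the cylinder is dominated. Dimension at least 2 keeps the punctured space
  connected.\<close>

lemma complete_radial_conformal_metric:
  assumes "2 \<le> CARD('n::finite)"
    and pos: "\<And>r. 0 < r \<Longrightarrow> 0 < \<phi> r" and le: "\<And>r. 0 < r \<Longrightarrow> \<phi> r \<le> sqrt r"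
    and cont: "continuous_on {0<..} \<phi>"
    and smooth: "smooth_on (- {0}) (\<lambda>x::real^'n. 1 / (\<phi> (sum_squares x))\<^sup>2)"
  shows "complete_riemannian_manifold (- {0}) (radial_conformal_metric \<phi> :: real^'n \<Rightarrow> real^'n^'n)"
proof -
  let ?\<rho> = "\<lambda>z::real^'n. 1 / \<phi> (sum_squares z)"
  have pos': "0 < \<phi> (sum_squares z)" if "z \<noteq> 0" for z :: "real^'n"
    using pos sum_squares_pos[OF that] .
  have "continuous_on (- {0}) (\<lambda>z::real^'n. \<phi> (sum_squares z))"
    by (rule continuous_on_compose2[OF cont])
      (auto simp: sum_squares_eq_inner intro!: continuous_intros)
  then have "continuous_on (- {0}) ?\<rho>"
    using pos' by (intro continuous_on_divide continuous_on_const) force+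
  moreover have "1 / norm z \<le> ?\<rho> z" if "z \<noteq> 0" for z :: "real^'n"
    using le[OF sum_squares_pos[OF that]] pos'[OF that] that
    by (intro divide_left_mono) (simp_all add: sum_squares_eq_inner norm_eq_sqrt_inner)
  moreover have "2 \<le> DIM(real^'n)"
    using assms(1) by simp
  ultimately have "Metric_space (- {0}) (\<lambda>x y. enn2real (weighted_dist (- {0}) ?\<rho> x y))"
      "Metric_space.mcomplete (- {0}) (\<lambda>x y. enn2real (weighted_dist (- {0}) ?\<rho> x y))"
    by (auto intro!: complete_punctured_space)
  moreover have "riemannian_metric_on (- {0}) (radial_conformal_metric \<phi> :: real^'n \<Rightarrow> real^'n^'n)"
    unfolding riemannian_metric_on_def
  proof (intro conjI ballI allI impI)
    show "smooth_on (- {0}) (radial_conformal_metric \<phi> :: real^'n \<Rightarrow> real^'n^'n)"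
      unfolding radial_conformal_metric_def euclidean_metric_def
      by (rule smooth_on_scaleR_left[OF _ smooth]) auto
    fix x :: "real^'n" assume x: "x \<in> - {0}"
    show "transpose (radial_conformal_metric \<phi> x) = radial_conformal_metric \<phi> x"
      by (simp add: vec_eq_iff transpose_def radial_conformal_metric_def euclidean_metric_def mat_def)
    show "0 < v \<bullet> (radial_conformal_metric \<phi> x *v v)" if "v \<noteq> 0" for v
      using pos'[of x] x that
      by (simp add: radial_conformal_metric_def euclidean_metric_def flip: scaleR_matrix_vector_assoc)
  qed auto
  moreover have "riemannian_dist (- {0}) (radial_conformal_metric \<phi> :: real^'n \<Rightarrow> real^'n^'n) =
      (\<lambda>x y. enn2real (weighted_dist (- {0}) ?\<rho> x y))"
    by (rule riemannian_dist_radial_conformal_metric) (rule pos)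
  ultimately show ?thesis
    by (simp only: complete_riemannian_manifold_def)
qed

section \<open>Factors of the form \<open>r exp (- u(r))\<close>\<close>

text \<open>For u = 0 the metric is \<open>\<bar>x\<bar>\<^sup>-\<^sup>4 g\<^sub>0\<close>, the
  pullback of the Euclidean metric under inversion, hence flat. In general \<phi>' / \<phi> = 1 / r
  - u', which gives the q of the interpretation below.\<close>

locale radial_exponential =
  fixes \<phi> u u' u'' :: "real \<Rightarrow> real"
  assumes phi_eq: "\<And>r. 0 < r \<Longrightarrow> \<phi> r = r * exp (- u r)"
    and deriv_u: "\<And>r. 0 < r \<Longrightarrow> (u has_real_derivative u' r) (at r)"
    and deriv_u': "\<And>r. 0 < r \<Longrightarrow> (u' has_real_derivative u'' r) (at r)"
begin

sublocale radial_conformal \<phi> "\<lambda>r. 2 * (u' r - 1 / r)" "\<lambda>r. 2 * (u'' r + 1 / r\<^sup>2)"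
proof
  fix r :: real assume r: "0 < r"
  then show "0 < \<phi> r"
    by (simp add: phi_eq)
  have "((\<lambda>r. r * exp (- u r)) has_real_derivative - (\<phi> r * (2 * (u' r - 1 / r)) / 2)) (at r)"
    using r deriv_u[OF r] by (auto intro!: derivative_eq_intros simp: phi_eq field_simps)
  then show "(\<phi> has_real_derivative - (\<phi> r * (2 * (u' r - 1 / r)) / 2)) (at r)"
    by (rule has_field_derivative_transform_within_open[where S = "{0<..}"]) (use r phi_eq in auto)
  show "((\<lambda>r. 2 * (u' r - 1 / r)) has_real_derivative 2 * (u'' r + 1 / r\<^sup>2)) (at r)"
    using r deriv_u'[OF r] by (auto intro!: derivative_eq_intros simp: field_simps power2_eq_square)
qed

text \<open>The terms free of u add up to (8 - 4 n + 4 (n - 2)) / r = 0, reflecting the flatness of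
  the case u = 0.\<close>

lemma scalar_curvature_radial_exponential:
  fixes x :: "real^'n::finite"
  assumes "x \<noteq> 0"
  defines "r \<equiv> sum_squares x" and "n \<equiv> real CARD('n)"
  shows "scalar_curvature (radial_conformal_metric \<phi>) x =
    - 4 * (n - 1) * (\<phi> r)\<^sup>2 * (2 * r * u'' r - (n - 4) * u' r + (n - 2) * r * (u' r)\<^sup>2)"
proof -
  have "0 < r"
    using sum_squares_pos[OF assms(1)] by (simp add: r_def)
  then have curvature_term: "4 * r * (2 * (u'' r + 1 / r\<^sup>2)) + 2 * n * (2 * (u' r - 1 / r)) + (n - 2) * r * (2 * (u' r - 1 / r))\<^sup>2
      = 4 * (2 * r * u'' r - (n - 4) * u' r + (n - 2) * r * (u' r)\<^sup>2)"
    by (simp add: field_simps power2_eq_square)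
  show ?thesis
    unfolding scalar_curvature_eq[OF assms(1)] r_def[symmetric] n_def[symmetric] curvature_term
    by algebra
qed

lemma complete_radial_exponential:
  assumes "2 \<le> CARD('n::finite)" "\<And>r. 0 < r \<Longrightarrow> sqrt r \<le> exp (u r)"
    and smooth: "smooth_on (- {0}) (\<lambda>x::real^'n. exp (2 * u (sum_squares x)))"
  shows "complete_riemannian_manifold (- {0}) (radial_conformal_metric \<phi> :: real^'n \<Rightarrow> real^'n^'n)"
proof (rule complete_radial_conformal_metric[OF assms(1) pos])
  show "\<phi> r \<le> sqrt r" if "0 < r" for r
  proof -
    have "r = sqrt r * sqrt r"
      using that by simp
    also have "\<dots> \<le> sqrt r * exp (u r)"
      using assms(2)[OF that] that by (intro mult_left_mono) auto
    finally show ?thesis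
      using that by (simp add: phi_eq exp_minus field_simps)
  qed
  show "continuous_on {0<..} \<phi>"
    using DERIV_isCont[OF deriv] by (simp add: continuous_at_imp_continuous_on)
  have "smooth_on (- {0}) (\<lambda>x::real^'n. sum_squares x powr (- 2) * exp (2 * u (sum_squares x)))"
    by (intro smooth_on_mult smooth smooth_on_powr smooth_on_sum_squares) (auto simp: sum_squares_pos)
  then show "smooth_on (- {0}) (\<lambda>x::real^'n. 1 / (\<phi> (sum_squares x))\<^sup>2)"
  proof (rule smooth_on_cong[rotated 2])
    show "sum_squares x powr (- 2) * exp (2 * u (sum_squares x)) = 1 / (\<phi> (sum_squares x))\<^sup>2"
      if "x \<in> - {0}" for x :: "real^'n"
      using sum_squares_pos[of x] that
      by (simp add: phi_eq powr_minus exp_minus exp_double field_simps)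
  qed auto
qed simp

end

section \<open>The three metrics\<close>

lemma phi_radial_conformal: "radial_conformal phi (\<lambda>r. - 1 / r) (\<lambda>r. 1 / r\<^sup>2)"
proof
  fix r :: real assume r: "0 < r"
  then show "0 < phi r"
    by (simp add: phi_def)
  have "sqrt r / r = 1 / sqrt r"
    using r by (simp add: field_simps)
  then show "(phi has_real_derivative - (phi r * (- 1 / r) / 2)) (at r)"
    unfolding phi_def[abs_def]
    using r by (auto intro!: derivative_eq_intros simp: field_simps)
  show "((\<lambda>r. - 1 / r) has_real_derivative 1 / r\<^sup>2) (at r)"
    using r by (auto intro!: derivative_eq_intros simp: power2_eq_square)
qed

lemma phi_complete:
  assumes "2 \<le> CARD('n::finite)"
  shows "complete_riemannian_manifold (- {0}) (radial_conformal_metric phi :: real^'n \<Rightarrow> real^'n^'n)"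
proof (rule complete_radial_conformal_metric[OF assms])
  show "continuous_on {0<..} phi"
    unfolding phi_def[abs_def] by (intro continuous_intros)
  have "smooth_on (- {0}) (\<lambda>x::real^'n. sum_squares x powr (- 1))"
    by (intro smooth_on_powr smooth_on_sum_squares) (auto simp: sum_squares_pos)
  then show "smooth_on (- {0}) (\<lambda>x::real^'n. 1 / (phi (sum_squares x))\<^sup>2)"
  proof (rule smooth_on_cong[rotated 2])
    show "sum_squares x powr (- 1) = 1 / (phi (sum_squares x))\<^sup>2" if "x \<in> - {0}" for x :: "real^'n"
      using sum_squares_pos[of x] that by (simp add: phi_def powr_minus divide_inverse)
  qed auto
qed (simp_all add: phi_def)

lemma phi_scalar_curvature:
  fixes x :: "real^'n::finite"
  assumes "x \<noteq> 0"
  shows "scalar_curvature (radial_conformal_metric phi) x = (real CARD('n) - 1) * (real CARD('n) - 2)"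
proof -
  interpret radial_conformal phi "\<lambda>r. - 1 / r" "\<lambda>r. 1 / r\<^sup>2"
    by (rule phi_radial_conformal)
  show ?thesis
    using sum_squares_pos[OF assms]
    by (simp add: scalar_curvature_eq[OF assms] phi_def field_simps power2_eq_square)
qed

text \<open>The metric \<open>\<phi>\<^sub>0\<^sup>-\<^sup>2 g\<^sub>0\<close> is the spatial Schwarzschild metric \<open>h\<^bsup>4/(n-2)\<^esup> g\<^sub>0\<close> for the harmonic
  function \<open>h(x) = 1 + \<bar>x\<bar>\<^bsup>2-n\<^esup>\<close>.\<close>

definition phi0 :: "nat \<Rightarrow> real \<Rightarrow> real" where
  "phi0 n r = r * (1 + r powr ((real n - 2) / 2)) powr (- 2 / (real n - 2))"

text \<open>The expression is the l^a norm (a quasinorm for a < 1) of the pair (1, r), so it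
  dominates both entries. The bound by r gives completeness, the bound by 1 the sign of the
  curvature.\<close>

lemma le_powr_one_plus_powr:
  fixes a r :: real
  assumes "0 < a" "0 < r"
  shows "r \<le> (1 + r powr a) powr (1 / a)" "1 < (1 + r powr a) powr (1 / a)"
proof -
  have "r = (r powr a) powr (1 / a)"
    using assms by (simp add: powr_powr)
  also have "\<dots> \<le> (1 + r powr a) powr (1 / a)"
    using assms by (intro powr_mono2) auto
  finally show "r \<le> (1 + r powr a) powr (1 / a)" .
  show "1 < (1 + r powr a) powr (1 / a)"
    using assms by (intro gr_one_powr) auto
qed

lemma sqrt_le_one_plus:
  assumes "0 \<le> r" shows "sqrt r \<le> 1 + r"
proof (rule real_le_lsqrt)
  show "r \<le> (1 + r)\<^sup>2"
    using assms by (simp add: power2_eq_square algebra_simps)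
qed (use assms in auto)

lemma smooth_on_one_plus_powr:
  "smooth_on (- {0}) (\<lambda>x::real^'n::finite. (1 + sum_squares x powr a) powr b)"
  by (intro smooth_on_powr smooth_on_add smooth_on_const smooth_on_sum_squares)
    (auto simp: sum_squares_pos add_pos_nonneg)

text \<open>The shifted exponents are written as quotients, so that later computations are rational
  in r, R = \<open>r powr a\<close> and X.\<close>

lemma has_real_derivative_one_plus_powr:
  fixes a r :: real
  assumes "0 < a" "0 < r"
  shows "((\<lambda>r. (1 + r powr a) powr (1 / a)) has_real_derivative
    (1 + r powr a) powr (1 / a) * r powr a / (r * (1 + r powr a))) (at r)"
proof -
  have P: "0 < 1 + r powr a"
    by (simp add: add_pos_nonneg)
  have "((\<lambda>r. (1 + r powr a) powr (1 / a)) has_real_derivative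
      1 / a * (1 + r powr a) powr (1 / a - 1) * (a * r powr (a - 1))) (at r)"
    using assms P by (auto intro!: derivative_eq_intros)
  also have "1 / a * (1 + r powr a) powr (1 / a - 1) * (a * r powr (a - 1)) =
      (1 + r powr a) powr (1 / a) * r powr a / (r * (1 + r powr a))"
    unfolding powr_diff using assms P by simp
  finally show ?thesis .
qed

text \<open>The second derivative comes from logarithmic differentiation of u' = X R / (r (1 + R)):
  the contributions R / (r (1 + R)), a / r, - 1 / r and - a R / (r (1 + R)) sum to (a - 1) / (r (1 +
  R)).\<close>

lemma phi1_radial_exponential:
  fixes n :: nat
  assumes "3 \<le> n"
  defines "a \<equiv> (real n - 2) / 2"
  defines "u' \<equiv> \<lambda>r. (1 + r powr a) powr (1 / a) * r powr a / (r * (1 + r powr a))"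
  shows "radial_exponential (phi1 n) (\<lambda>r. (1 + r powr a) powr (1 / a)) u'
    (\<lambda>r. (a - 1) * u' r / (r * (1 + r powr a)))"
proof
  fix r :: real assume r: "0 < r"
  have a: "0 < a" "1 / a = 2 / (real n - 2)"
    using assms(1) by (auto simp: a_def)
  show "phi1 n r = r * exp (- ((1 + r powr a) powr (1 / a)))"
    by (simp add: phi1_def a(2)) (simp add: a_def)
  show "((\<lambda>r. (1 + r powr a) powr (1 / a)) has_real_derivative u' r) (at r)"
    unfolding u'_def by (rule has_real_derivative_one_plus_powr[OF a(1) r])
  define R where "R = r powr a"
  define X where "X = (1 + R) powr (1 / a)"
  have R: "0 < R"
    using r by (simp add: R_def)
  have "((\<lambda>r. r powr a) has_real_derivative a * R / r) (at r)"
    using r by (auto intro!: derivative_eq_intros simp: powr_diff R_def)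
  moreover have "((\<lambda>r. (1 + r powr a) powr (1 / a)) has_real_derivative X * R / (r * (1 + R))) (at r)"
    using has_real_derivative_one_plus_powr[OF a(1) r] by (simp add: X_def R_def)
  ultimately have "(u' has_real_derivative
      (((X * R / (r * (1 + R))) * R + a * R / r * X) * (r * (1 + R)) - X * R * (1 * (1 + R) + a * R / r * r))
        / ((r * (1 + R)) * (r * (1 + R)))) (at r)"
    unfolding u'_def using r R
    by (intro DERIV_cong[OF DERIV_divide[OF DERIV_mult DERIV_mult[OF DERIV_ident DERIV_add[OF DERIV_const]]]])
      (auto simp: R_def[symmetric] X_def[symmetric])
  moreover have "(((X * R / (r * (1 + R))) * R + a * R / r * X) * (r * (1 + R)) - X * R * (1 * (1 + R) + a * R / r * r))
        / ((r * (1 + R)) * (r * (1 + R))) = (a - 1) * (X * R / (r * (1 + R))) / (r * (1 + R))"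
    using r R by (simp add: divide_simps) (simp add: algebra_simps)
  ultimately show "(u' has_real_derivative (a - 1) * u' r / (r * (1 + r powr a))) (at r)"
    by (simp only: u'_def R_def X_def)
qed

lemma phi1_complete:
  assumes "3 \<le> CARD('n::finite)"
  shows "complete_riemannian_manifold (- {0})
    (radial_conformal_metric (phi1 CARD('n)) :: real^'n \<Rightarrow> real^'n^'n)"
proof (rule radial_exponential.complete_radial_exponential[OF phi1_radial_exponential[OF assms]])
  define a where "a = (real CARD('n) - 2) / 2"
  have a: "0 < a"
    using assms by (simp add: a_def)
  show "sqrt r \<le> exp ((1 + r powr ((real CARD('n) - 2) / 2)) powr (1 / ((real CARD('n) - 2) / 2)))"
    if "0 < r" for r
  proof -
    have "sqrt r \<le> 1 + r"
      using that by (intro sqrt_le_one_plus) simp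
    also have "\<dots> \<le> exp r"
      by (rule exp_ge_add_one_self)
    also have "\<dots> \<le> exp ((1 + r powr a) powr (1 / a))"
      using le_powr_one_plus_powr(1)[OF a that] by simp
    finally show ?thesis
      by (simp only: a_def)
  qed
  show "smooth_on (- {0}) (\<lambda>x::real^'n.
      exp (2 * (1 + sum_squares x powr ((real CARD('n) - 2) / 2)) powr (1 / ((real CARD('n) - 2) / 2))))"
    by (intro smooth_on_exp smooth_on_mult smooth_on_const smooth_on_one_plus_powr) auto
qed (use assms in simp)

lemma phi1_scalar_curvature_neg:
  fixes x :: "real^'n::finite"
  assumes "3 \<le> CARD('n)" "x \<noteq> 0"
  shows "scalar_curvature (radial_conformal_metric (phi1 CARD('n))) x < 0"
proof -
  define n where "n = real CARD('n)"
  define a where "a = (n - 2) / 2"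
  define r where "r = sum_squares x"
  define R where "R = r powr a"
  define X where "X = (1 + R) powr (1 / a)"
  define u' where "u' = X * R / (r * (1 + R))"
  have r: "0 < r"
    using sum_squares_pos[OF assms(2)] by (simp add: r_def)
  have a: "0 < a" and n: "n = 2 * a + 2"
    using assms(1) by (simp_all add: a_def n_def field_simps)
  have R: "0 < R" and X: "1 < X"
    using r le_powr_one_plus_powr(2)[OF a r] by (simp_all add: R_def X_def)
  interpret radial_exponential "phi1 CARD('n)" "\<lambda>r. (1 + r powr a) powr (1 / a)"
    "\<lambda>r. (1 + r powr a) powr (1 / a) * r powr a / (r * (1 + r powr a))"
    "\<lambda>r. (a - 1) * ((1 + r powr a) powr (1 / a) * r powr a / (r * (1 + r powr a))) / (r * (1 + r powr a))"
    using phi1_radial_exponential[OF assms(1)] by (simp only: a_def n_def)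
  have "scalar_curvature (radial_conformal_metric (phi1 CARD('n))) x = - 4 * (n - 1) * (phi1 CARD('n) r)\<^sup>2 *
      (2 * r * ((a - 1) * u' / (r * (1 + R))) - (n - 4) * u' + (n - 2) * r * u'\<^sup>2)"
    unfolding scalar_curvature_radial_exponential[OF assms(2)]
    by (simp only: u'_def X_def R_def r_def n_def)
  \<comment> \<open>Let v = ln (1 + R) / a, so that X = exp v and r v' = R / (1 + R). The bracket
    vanishes for v, and for exp v the chain rule leaves 2 r X v'^2 (1 - a + a X), which is positive
    because X > 1.\<close>
  also have "2 * r * ((a - 1) * u' / (r * (1 + R))) - (n - 4) * u' + (n - 2) * r * u'\<^sup>2 =
      2 * u' * (R / (1 + R)) * (a * (X - 1) + 1)"
    unfolding n u'_def using r R
    by (simp add: divide_simps power2_eq_square) (simp add: algebra_simps)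
  finally have eq: "scalar_curvature (radial_conformal_metric (phi1 CARD('n))) x =
      - (4 * (n - 1) * (phi1 CARD('n) r)\<^sup>2 * (2 * u' * (R / (1 + R)) * (a * (X - 1) + 1)))"
    by (simp only: mult_minus_left)
  have "0 < phi1 CARD('n) r"
    by (rule pos[OF r])
  moreover have "0 < u'" "0 < R / (1 + R)" "0 < n - 1" "0 < a * (X - 1) + 1"
    using r R X a n by (auto simp: u'_def intro!: divide_pos_pos mult_pos_pos add_pos_pos)
  ultimately show ?thesis
    unfolding eq by (simp only: neg_less_0_iff_less) (intro mult_pos_pos; simp)
qed

text \<open>The second derivative is expressed through u' on purpose: with n = 2 a + 2 this Riccati
  equation is exactly the vanishing of the curvature bracket, whatever the value of u'.\<close>

lemma phi0_radial_exponential: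
  fixes n :: nat
  assumes "3 \<le> n"
  defines "a \<equiv> (real n - 2) / 2"
  defines "u' \<equiv> \<lambda>r. r powr a / (r * (1 + r powr a))"
  shows "radial_exponential (phi0 n) (\<lambda>r. ln (1 + r powr a) / a) u'
    (\<lambda>r. ((a - 1) * u' r - a * r * (u' r)\<^sup>2) / r)"
proof
  fix r :: real assume r: "0 < r"
  have a: "0 < a" "2 / (real n - 2) = 1 / a"
    using assms(1) by (auto simp: a_def)
  define R where "R = r powr a"
  have R: "0 < R"
    using r by (simp add: R_def)
  have "- 2 / (real n - 2) = - (1 / a)"
    using a(2) by simp
  then have "phi0 n r = r * (1 + R) powr (- (1 / a))"
    by (simp only: phi0_def R_def a_def)
  then show "phi0 n r = r * exp (- (ln (1 + r powr a) / a))"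
    unfolding R_def[symmetric] using R by (simp add: powr_def)
  have DR: "((\<lambda>r. r powr a) has_real_derivative a * R / r) (at r)"
    using r by (auto intro!: derivative_eq_intros simp: powr_diff R_def)
  then show "((\<lambda>r. ln (1 + r powr a) / a) has_real_derivative u' r) (at r)"
    using r R a(1)
    by (intro DERIV_cong[OF DERIV_cdivide[OF DERIV_chain2[OF DERIV_ln DERIV_add[OF DERIV_const]]]])
      (auto simp: u'_def R_def[symmetric] divide_inverse)
  have "(u' has_real_derivative
      (a * R / r * (r * (1 + R)) - R * (1 * (1 + R) + a * R / r * r)) / ((r * (1 + R)) * (r * (1 + R)))) (at r)"
    unfolding u'_def using r R DR
    by (intro DERIV_cong[OF DERIV_divide[OF _ DERIV_mult[OF DERIV_ident DERIV_add[OF DERIV_const]]]])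
      (auto simp: R_def[symmetric])
  moreover have "(a * R / r * (r * (1 + R)) - R * (1 * (1 + R) + a * R / r * r)) / ((r * (1 + R)) * (r * (1 + R)))
      = ((a - 1) * (R / (r * (1 + R))) - a * r * (R / (r * (1 + R)))\<^sup>2) / r"
    using r R by (simp add: divide_simps power2_eq_square) (simp add: algebra_simps)
  ultimately show "(u' has_real_derivative ((a - 1) * u' r - a * r * (u' r)\<^sup>2) / r) (at r)"
    by (simp add: u'_def R_def)
qed

lemma phi0_complete:
  assumes "3 \<le> CARD('n::finite)"
  shows "complete_riemannian_manifold (- {0})
    (radial_conformal_metric (phi0 CARD('n)) :: real^'n \<Rightarrow> real^'n^'n)"
proof (rule radial_exponential.complete_radial_exponential[OF phi0_radial_exponential[OF assms]])
  define a where "a = (real CARD('n) - 2) / 2"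
  have a: "0 < a"
    using assms by (simp add: a_def)
  \<comment> \<open>Used with c = 1 for the bound on the factor and with c = 2 for the smoothness of
    the metric.\<close>
  have exp_ln: "exp (c * (ln (1 + r powr a) / a)) = (1 + r powr a) powr (c / a)" for c r
    unfolding powr_def[of "1 + r powr a"] by (simp add: add_nonneg_eq_0_iff)
  show "sqrt r \<le> exp (ln (1 + r powr ((real CARD('n) - 2) / 2)) / ((real CARD('n) - 2) / 2))"
    if "0 < r" for r
  proof -
    let ?X = "(1 + r powr a) powr (1 / a)"
    have "r \<le> ?X\<^sup>2"
      using le_powr_one_plus_powr[OF a that] self_le_power[of ?X 2] by simp
    then have "sqrt r \<le> ?X"
      by (intro real_le_lsqrt) (use that in auto)
    then show ?thesis
      using exp_ln[of 1 r] by (simp add: a_def)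
  qed
  have "smooth_on (- {0}) (\<lambda>x::real^'n. exp (2 * (ln (1 + sum_squares x powr a) / a)))"
    unfolding exp_ln by (rule smooth_on_one_plus_powr)
  then show "smooth_on (- {0}) (\<lambda>x::real^'n.
      exp (2 * (ln (1 + sum_squares x powr ((real CARD('n) - 2) / 2)) / ((real CARD('n) - 2) / 2))))"
    by (simp only: a_def)
qed (use assms in simp)

lemma phi0_scalar_curvature:
  fixes x :: "real^'n::finite"
  assumes "3 \<le> CARD('n)" "x \<noteq> 0"
  shows "scalar_curvature (radial_conformal_metric (phi0 CARD('n))) x = 0"
proof -
  have vanish: "2 * r * (((a - 1) * u' - a * r * u'\<^sup>2) / r) - (n - 4) * u' + (n - 2) * r * u'\<^sup>2 = 0"
    if "0 < r" "a = (n - 2) / 2" for r u' a n :: real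
  proof -
    have "n = 2 * a + 2"
      using that(2) by simp
    then show ?thesis
      using that(1) by (simp add: field_simps power2_eq_square)
  qed
  show ?thesis
    unfolding radial_exponential.scalar_curvature_radial_exponential[OF phi0_radial_exponential[OF assms(1)] assms(2)]
    by (simp only: vanish[OF sum_squares_pos[OF assms(2)] refl] mult_zero_right)
qed

theorem corollary1p12:
  assumes "CARD('n::finite) \<ge> 3"
  shows "(complete_riemannian_manifold (- {0}) (radial_conformal_metric phi :: real^'n \<Rightarrow> real^'n^'n) \<and>
          (\<forall>x::real^'n. x \<noteq> 0 \<longrightarrow> scalar_curvature (radial_conformal_metric phi) x > 0)) \<and>
         (complete_riemannian_manifold (- {0})
            (radial_conformal_metric (phi1 CARD('n)) :: real^'n \<Rightarrow> real^'n^'n) \<and>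
          (\<forall>x::real^'n. x \<noteq> 0 \<longrightarrow>
             scalar_curvature (radial_conformal_metric (phi1 CARD('n))) x < 0)) \<and>
         (\<exists>g :: real^'n \<Rightarrow> real^'n^'n.
            complete_riemannian_manifold (- {0}) g \<and>
            (\<forall>x. x \<noteq> 0 \<longrightarrow> scalar_curvature g x = 0))"
proof (intro conjI allI impI exI[of _ "radial_conformal_metric (phi0 CARD('n))"])
  show "0 < scalar_curvature (radial_conformal_metric phi) x" if "x \<noteq> 0" for x :: "real^'n"
    using assms that by (simp add: phi_scalar_curvature)
qed (use assms in \<open>simp_all add: phi_complete phi1_complete phi0_complete
    phi1_scalar_curvature_neg phi0_scalar_curvature\<close>)

end
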